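(* Let $s\in\mathbb{C}$ with $0<\operatorname{Re}s<1$, $s\neq\frac12$. There is a bijective correspondence between the space $\ker(\mathcal{L}_s-1)\oplus\ker(\mathcal{L}_s+1)$ and the space $\ker(\tilde{\mathcal{L}}_s-1)$.
   Context: Mayer's transfer operator: $\mathcal{L}_s f(z)=\sum_{n=1}^\infty (z+n)^{-2s} f\!\left(\frac{1}{z+n}\right)$, acting on the Banach space (supremum norm) of functions continuous on the closed disk $\{|z-1|\le \frac32\}$ and holomorphic on its interior. The series converges absolutely for $\operatorname{Re}s>\frac12$, and $\mathcal{L}_s$ extends meromorphically in $s$, its only singularity in $\operatorname{Re}s>0$ being a pole at $s=\frac12$; for other $s$ with $\operatorname{Re} s>0$ the operator is defined by this continuation. The nearest integer transfer operator $\tilde{\mathcal{L}}_s$ acts on the Banach space (supremum norm) of pairs $(f_1,f_2)$ of functions continuous on the closed unit disk $\{|z|\le1\}$ and holomorphic on the open unit disk, by $\tilde{\mathcal{L}}_s(f_1,f_2)=(F_1,F_2)$ with $F_1(z)=\sum_{n=3}^\infty (z+n)^{-2s} f_1\!\left(\frac{-1}{z+n}\right)+\sum_{n=2}^\infty (n-z)^{-2s} f_2\!\left(\frac{1}{n-z}\right)$, $F_2(z)=\sum_{n=2}^\infty (z+n)^{-2s} f_1\!\left(\frac{-1}{z+n}\right)+\sum_{n=3}^\infty (n-z)^{-2s} f_2\!\left(\frac{1}{n-z}\right)$. These converge absolutely for $\operatorname{Re}s>\frac12$ and $\tilde{\mathcal{L}}_s$ is defined for other $s$ with $\operatorname{Re}s>0$,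 $s\ne\frac12$, by meromorphic continuation in $s$ (the only singularity in $\operatorname{Re}s>0$ is a first order pole at $s=\frac12$). Powers $w^{-2s}$ denote the principal branch. *)

theory Defs
  imports "HOL-Complex_Analysis.Complex_Analysis" "HOL-Library.Function_Algebras"
begin

definition is_continuation :: "(complex \<Rightarrow> complex) \<Rightarrow> (complex \<Rightarrow> complex) \<Rightarrow> bool" where
  "is_continuation g h \<longleftrightarrow>
     h meromorphic_on {s. Re s > 0} \<and>
     h holomorphic_on ({s. Re s > 0} - {1/2}) \<and>
     (\<forall>s. Re s > 1/2 \<longrightarrow> h s = g s)"

text \<open>
  The value at \<^term>\<open>s\<close> of the continuation of \<^term>\<open>g\<close> from the half-plane
  \<open>Re s > 1/2\<close> to \<open>Re s > 0\<close>, \<open>s \<noteq> 1/2\<close>. It does not depend on the choice of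
  continuation by the lemma below; it is only meaningful when a continuation exists.
\<close>

definition continuation :: "(complex \<Rightarrow> complex) \<Rightarrow> complex \<Rightarrow> complex" where
  "continuation g s = (THE w. \<exists>h. is_continuation g h \<and> h s = w)"

lemma is_continuation_unique:
  assumes "is_continuation g h" "is_continuation g h'" "Re s > 0" "s \<noteq> 1/2"
  shows "h s = h' s"
proof (rule analytic_continuation_open[of "{s. Re s > 1/2}" "{s. Re s > 0} - {1/2}" h h'])
  show "open {s. Re s > 1/2}" "open ({s. Re s > 0} - {1/2})"
    by (intro open_halfspace_Re_gt open_delete)+
  show "connected ({s. Re s > 0} - {1/2})"
    by (intro connected_open_delete open_halfspace_Re_gt convex_connected convex_halfspace_Re_gt)
       simp
  have "(1::complex) \<in> {s. Re s > 1/2}" by simp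
  then show "{s. Re s > 1/2} \<noteq> {}" by blast
qed (use assms in \<open>auto simp: is_continuation_def\<close>)

lemma continuation_eq:
  assumes "is_continuation g h" "Re s > 0" "s \<noteq> 1/2"
  shows "continuation g s = h s"
  unfolding continuation_def
  by (rule the_equality) (use assms is_continuation_unique in blast)+

text \<open>
  Functions on a closed disk are represented by their extension by \<open>0\<close> to the whole plane, so that
  two elements are equal iff they agree on the disk.
\<close>

definition disk_algebra :: "complex \<Rightarrow> real \<Rightarrow> (complex \<Rightarrow> complex) set" where
  "disk_algebra a r =
     {f. continuous_on (cball a r) f \<and> f holomorphic_on ball a r \<and> (\<forall>z. z \<notin> cball a r \<longrightarrow> f z = 0)}"

definition mayer_space :: "(complex \<Rightarrow> complex) set" where
  "mayer_space = disk_algebra 1 (3/2)"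

definition nearest_space :: "((complex \<Rightarrow> complex) \<times> (complex \<Rightarrow> complex)) set" where
  "nearest_space = disk_algebra 0 1 \<times> disk_algebra 0 1"

text \<open>
  A series \<open>\<Sum>n = k..\<infinity>. a n\<close> is written \<open>\<Sum>n. a (n + k)\<close>. On complex numbers,
  \<open>powr\<close> is the principal branch of the power. The meromorphic continuation of
  the operator family is evaluated at a fixed function and a fixed point of the disk; for
  \<open>Re s > 1/2\<close> its value is the value of the series.
\<close>

definition mayer_op :: "complex \<Rightarrow> (complex \<Rightarrow> complex) \<Rightarrow> complex \<Rightarrow> complex" where
  "mayer_op s f = (\<lambda>z. if z \<in> cball 1 (3/2) then
     continuation (\<lambda>t. \<Sum>n. (z + of_nat (n+1)) powr (-2*t) * f (1 / (z + of_nat (n+1)))) s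
     else 0)"

definition nearest_op ::
  "complex \<Rightarrow> (complex \<Rightarrow> complex) \<times> (complex \<Rightarrow> complex) \<Rightarrow> (complex \<Rightarrow> complex) \<times> (complex \<Rightarrow> complex)" where
  "nearest_op s = (\<lambda>(f\<^sub>1, f\<^sub>2).
    ((\<lambda>z. if z \<in> cball 0 1 then
        continuation (\<lambda>t.
          (\<Sum>n. (z + of_nat (n+3)) powr (-2*t) * f\<^sub>1 (-1 / (z + of_nat (n+3)))) +
          (\<Sum>n. (of_nat (n+2) - z) powr (-2*t) * f\<^sub>2 (1 / (of_nat (n+2) - z)))) s
        else 0),
     (\<lambda>z. if z \<in> cball 0 1 then
        continuation (\<lambda>t.
          (\<Sum>n. (z + of_nat (n+2)) powr (-2*t) * f\<^sub>1 (-1 / (z + of_nat (n+2)))) +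
          (\<Sum>n. (of_nat (n+3) - z) powr (-2*t) * f\<^sub>2 (1 / (of_nat (n+3) - z)))) s
        else 0)))"

definition ker_on :: "'a set \<Rightarrow> ('a \<Rightarrow> 'b::zero) \<Rightarrow> 'a set" where
  "ker_on X A = {f \<in> X. A f = 0}"

definition pair_scale ::
  "complex \<Rightarrow> (complex \<Rightarrow> complex) \<times> (complex \<Rightarrow> complex) \<Rightarrow> (complex \<Rightarrow> complex) \<times> (complex \<Rightarrow> complex)" where
  "pair_scale c p = ((\<lambda>z. c * fst p z), (\<lambda>z. c * snd p z))"

definition pair_linear_on ::
  "((complex \<Rightarrow> complex) \<times> (complex \<Rightarrow> complex)) set \<Rightarrow>
   ((complex \<Rightarrow> complex) \<times> (complex \<Rightarrow> complex) \<Rightarrow> (complex \<Rightarrow> complex) \<times> (complex \<Rightarrow> complex)) \<Rightarrow> bool" where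
  "pair_linear_on V \<phi> \<longleftrightarrow>
     (\<forall>p\<in>V. \<forall>q\<in>V. \<phi> (p + q) = \<phi> p + \<phi> q) \<and>
     (\<forall>c. \<forall>p\<in>V. \<phi> (pair_scale c p) = pair_scale c (\<phi> p))"

end

theory Submission
  imports Defs
begin

text \<open>
  For \<open>Re s > 0\<close>, \<open>s \<noteq> 1/2\<close> the continued value of \<open>\<Sum>n. (x + n) powr (-2s) * F (1 / (x + n))\<close> is
  the unique \<open>l\<close> such that the partial sums minus \<open>c * N powr (1 - 2s)\<close> tend to \<open>l\<close> for some \<open>c\<close>.
  Hence continued sums can be evaluated by telescoping.

  Under \<open>(f\<^sub>1 z, f\<^sub>2 z) \<mapsto> (f\<^sub>2 (-z), f\<^sub>1 (-z))\<close> the kernel of the nearest integer operator splits into parts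
  of sign \<open>\<epsilon> = \<plusminus>1\<close>, on which \<open>h = f\<^sub>2\<close> determines the pair. Put \<open>B z = \<epsilon> * (\<Sum>n\<ge>2. (z + n) powr (-2s) * h (1 / (z + n)))\<close>,
  so that the eigenfunction equation reads \<open>h z = B z + \<epsilon> * B (1 - z)\<close>. In terms of the cocycle \<open>c\<close> attached to a
  period function, \<open>c (0, \<infinity>)\<close> is the eigenfunction \<open>f\<close> of Mayer's operator at \<open>z - 1\<close>, \<open>B = c (-phi, \<infinity>)\<close> and
  \<open>h = c (-phi, phi\<^sup>2)\<close> with the golden ratio \<open>phi\<close>. This suggests the map \<open>h \<mapsto> f\<close>,
  \<open>f z = B z + \<epsilon> * (z + 1) powr (-2s) * B (1 / (z + 1))\<close>, for which \<open>w powr (-2s) * f (1 / w)\<close> telescopes.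
  The inverse solves \<open>B z - (z + 2) powr (-2s) * B ((z + 1) / (z + 2)) = f (z + 1)\<close> by a Neumann series; the
  solution is unique because the Moebius map is hyperbolic and \<open>Re s > 0\<close>.
\<close>

section \<open>Regularised limits\<close>

lemma norm_powr_le:
  fixes w q :: complex
  assumes "0 < b" "b \<le> Re w" "Re q \<le> 0"
  shows "norm (w powr q) \<le> b powr Re q * exp (pi * \<bar>Im q\<bar>)"
proof -
  have "Re w > 0" using assms by simp
  then have "\<bar>Arg w\<bar> \<le> pi" using Arg_bounded[of w] by (auto simp: abs_if)
  then have "- Im q * Arg w \<le> \<bar>Im q\<bar> * pi"
    using mult_left_mono[of "\<bar>Arg w\<bar>" pi "\<bar>Im q\<bar>"] abs_ge_self[of "- Im q * Arg w"]
    by (simp add: abs_mult)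
  moreover have "norm w powr Re q \<le> b powr Re q"
    using assms complex_Re_le_cmod[of w] by (intro powr_mono2') auto
  ultimately show ?thesis
    unfolding norm_powr_complex by (intro mult_mono) (auto simp: mult.commute)
qed

lemma not_nonpos_Reals: "Re w > 0 \<Longrightarrow> w \<notin> \<real>\<^sub>\<le>\<^sub>0"
  by (auto simp: complex_nonpos_Reals_iff)

text \<open>Taylor expansion in the half-plane to the right of \<open>w\<close>, where
  \<open>Re p \<le> 2\<close> bounds the second derivative by a power of \<open>Re w\<close>. For
  \<open>p = 1 - 2 * t\<close> the remainder has order \<open>Re w powr (- 2 * Re t - 1)\<close>,
  which is summable along \<open>w = x + n\<close> as soon as \<open>Re t > 0\<close>.\<close>

lemma powr_Taylor:
  fixes w p :: complex
  assumes "0 < Re w" "Re p \<le> 2"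
  shows "norm ((w + 1) powr p - w powr p - p * w powr (p - 1))
           \<le> norm (p * (p - 1)) * (Re w powr (Re p - 2) * exp (pi * \<bar>Im p\<bar>))"
proof -
  define f where "f i = (\<lambda>x::complex. if i = 0 then x powr p else if i = Suc 0 then p * x powr (p - 1)
      else p * (p - 1) * x powr (p - 2))" for i :: nat
  have "norm (f 0 (w+1) - (\<Sum>i\<le>1. f i w * (w + 1 - w) ^ i / fact i))
      \<le> norm (p * (p - 1)) * (Re w powr (Re p - 2) * exp (pi * \<bar>Im p\<bar>)) * norm (w + 1 - w) ^ Suc 1 / fact 1"
  proof (rule complex_Taylor)
    show "convex {x. Re w \<le> Re x}" by (rule convex_halfspace_Re_ge)
    show "(f i has_field_derivative f (Suc i) x) (at x within {x. Re w \<le> Re x})"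
      if x: "x \<in> {x. Re w \<le> Re x}" "i \<le> 1" for i x
    proof -
      have nr: "x \<notin> \<real>\<^sub>\<le>\<^sub>0" using x assms by (intro not_nonpos_Reals) auto
      consider "i = 0" | "i = 1" using x by linarith
      then show ?thesis
      proof cases
        case 1
        then show ?thesis
          using has_field_derivative_powr[OF nr, of p]
          by (auto simp: f_def intro: has_field_derivative_at_within)
      next
        case 2
        have "((\<lambda>x. p * x powr (p - 1)) has_field_derivative p * ((p - 1) * x powr (p - 1 - 1))) (at x)"
          by (intro DERIV_cmult has_field_derivative_powr nr)
        then show ?thesis
          using 2 by (auto simp: f_def mult.assoc intro: has_field_derivative_at_within)
      qed
    qed
    show "norm (f (Suc 1) x) \<le> norm (p * (p - 1)) * (Re w powr (Re p - 2) * exp (pi * \<bar>Im p\<bar>))"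
      if "x \<in> {x. Re w \<le> Re x}" for x
      using norm_powr_le[of "Re w" x "p - 2"] that assms
      by (auto simp: f_def norm_mult intro!: mult_left_mono)
  qed (use assms in auto)
  then show ?thesis by (simp add: f_def algebra_simps)
qed

text \<open>By the mean value estimate the difference is of order \<open>N powr (Re p - 1)\<close>.
  For \<open>p = 1 - 2 * s\<close> this makes the regularisation independent of the base point
  \<open>x\<close>.\<close>

lemma powr_shift_tendsto_0:
  fixes x p :: complex
  assumes "0 < Re x" "Re p < 1"
  shows "(\<lambda>N. (x + of_nat N) powr p - of_nat N powr p) \<longlonglongrightarrow> 0"
proof (rule Lim_null_comparison)
  show "\<forall>\<^sub>F N in sequentially. norm ((x + of_nat N) powr p - of_nat N powr p)
      \<le> norm p * (real N powr (Re p - 1) * exp (pi * \<bar>Im p\<bar>)) * norm x"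
    using eventually_gt_at_top[of 0]
  proof eventually_elim
    case (elim N)
    have "norm ((x + of_nat N) powr p - of_nat N powr p)
      \<le> norm p * (real N powr (Re p - 1) * exp (pi * \<bar>Im p\<bar>)) * norm (x + of_nat N - of_nat N)"
    proof (rule field_differentiable_bound)
      show "convex {x. real N \<le> Re x}" by (rule convex_halfspace_Re_ge)
      show "((\<lambda>x. x powr p) has_field_derivative p * z powr (p - 1)) (at z within {x. real N \<le> Re x})"
        if "z \<in> {x. real N \<le> Re x}" for z
        using that elim
        by (intro has_field_derivative_at_within[OF has_field_derivative_powr] not_nonpos_Reals) auto
      show "norm (p * z powr (p - 1)) \<le> norm p * (real N powr (Re p - 1) * exp (pi * \<bar>Im p\<bar>))"
        if "z \<in> {x. real N \<le> Re x}" for z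
        using norm_powr_le[of "real N" z "p - 1"] that elim assms
        by (auto simp: norm_mult intro!: mult_left_mono)
    qed (use assms in auto)
    then show ?case by simp
  qed
  have "(\<lambda>N. real N powr (Re p - 1)) \<longlonglongrightarrow> 0"
    using assms by (intro tendsto_neg_powr filterlim_real_sequentially) auto
  from tendsto_mult_left[OF tendsto_mult_right[OF this], of "norm p * exp (pi * \<bar>Im p\<bar>)" "norm x"]
  show "(\<lambda>N. norm p * (real N powr (Re p - 1) * exp (pi * \<bar>Im p\<bar>)) * norm x) \<longlonglongrightarrow> 0"
    by (simp add: mult_ac)
qed

text \<open>A nonzero limit, compared along the subsequence \<open>k * N\<close>, forces
  \<open>of_nat k powr p = 1\<close> for every \<open>k > 0\<close>. Then \<open>1 + 1 / n\<close>
  has power 1 as well, so the derivative \<open>p\<close> of the power at 1 would vanish. This also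
  covers purely imaginary \<open>p\<close>, where the powers are bounded but oscillate.\<close>

lemma of_nat_powr_convergent_imp_0:
  fixes p :: complex
  assumes lim: "(\<lambda>N. of_nat N powr p) \<longlonglongrightarrow> m" and "p \<noteq> 0" 
  shows "m = 0"
proof (rule ccontr)
  assume "m \<noteq> 0"
  have *: "of_nat k powr p = 1" if "k > 0" for k :: nat
  proof -
    have "(\<lambda>N. of_nat (k * N) powr p) \<longlonglongrightarrow> m"
      by (rule filterlim_compose[OF lim])
         (use that in \<open>auto intro!: mult_nat_left_at_top\<close>)
    moreover have "of_nat (k * N) powr p = of_nat k powr p * of_nat N powr p" for N
      using powr_times_real[of "of_nat k" "of_nat N" p] by simp
    ultimately have "(\<lambda>N. of_nat k powr p * of_nat N powr p) \<longlonglongrightarrow> m" by simp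
    moreover have "(\<lambda>N. of_nat k powr p * of_nat N powr p) \<longlonglongrightarrow> of_nat k powr p * m"
      by (intro tendsto_intros lim)
    ultimately have "of_nat k powr p * m = m" by (rule LIMSEQ_unique[rotated])
    with \<open>m \<noteq> 0\<close> show ?thesis by simp
  qed
  have 1: "((\<lambda>x. x powr p) has_field_derivative p) (at (1::complex))"
    using has_field_derivative_powr[of 1 p] by simp
  have lim0: "(\<lambda>n. 1 / of_nat (Suc n) :: complex) \<longlonglongrightarrow> 0"
    using LIMSEQ_Suc[OF lim_1_over_n] by simp
  have "filterlim (\<lambda>n. 1 / of_nat (Suc n) :: complex) (at 0) sequentially"
    using lim0 by (auto simp: filterlim_at intro!: always_eventually simp del: of_nat_Suc)
  from filterlim_compose[OF 1[unfolded DERIV_def] this]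
  have "(\<lambda>n. ((1 + 1 / of_nat (Suc n)) powr p - 1 powr p) / (1 / of_nat (Suc n))) \<longlonglongrightarrow> p" .
  moreover have "(1 + 1 / of_nat (Suc n) :: complex) powr p = 1" for n
  proof -
    have "real (Suc (Suc n)) = (1 + 1 / real (Suc n)) * real (Suc n)"
      by (simp add: distrib_right)
    then have "of_nat (Suc (Suc n)) = (of_real (1 + 1 / real (Suc n)) * of_nat (Suc n) :: complex)"
      by (metis of_real_mult of_real_of_nat_eq)
    also have "\<dots> powr p = of_real (1 + 1 / real (Suc n)) powr p * of_nat (Suc n) powr p"
      by (rule powr_times_real) (auto simp del: of_nat_Suc)
    also have "of_real (1 + 1 / real (Suc n)) = (1 + 1 / of_nat (Suc n) :: complex)" by simp
    finally have "of_nat (Suc (Suc n)) powr p = (1 + 1 / of_nat (Suc n) :: complex) powr p * of_nat (Suc n) powr p" .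
    then show ?thesis using *[of "Suc n"] *[of "Suc (Suc n)"] by simp
  qed
  ultimately have "(\<lambda>n. 0) \<longlonglongrightarrow> p" by simp
  then show False using \<open>p \<noteq> 0\<close> by (simp add: LIMSEQ_const_iff)
qed

text \<open>A finite part in the sense of Hadamard with a single divergent term. The coefficient
  \<open>c\<close> is quantified away, so linear rules need not track it.\<close>

definition reg_limit :: "complex \<Rightarrow> (nat \<Rightarrow> complex) \<Rightarrow> complex \<Rightarrow> bool" where
  "reg_limit s a l \<longleftrightarrow> (\<exists>c. (\<lambda>N. a N - c * of_nat N powr (1 - 2 * s)) \<longlonglongrightarrow> l)"

lemma reg_limit_tendsto: "a \<longlonglongrightarrow> l \<Longrightarrow> reg_limit s a l"
  unfolding reg_limit_def by (rule exI[of _ 0]) simp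

lemma reg_limit_add:
  assumes "reg_limit s a l" "reg_limit s b m"
  shows "reg_limit s (\<lambda>N. a N + b N) (l + m)"
proof -
  obtain c d where "(\<lambda>N. a N - c * of_nat N powr (1 - 2 * s)) \<longlonglongrightarrow> l"
     "(\<lambda>N. b N - d * of_nat N powr (1 - 2 * s)) \<longlonglongrightarrow> m"
    using assms unfolding reg_limit_def by blast
  from tendsto_add[OF this] show ?thesis
    unfolding reg_limit_def by (intro exI[of _ "c + d"]) (simp add: algebra_simps)
qed

lemma reg_limit_cmult:
  assumes "reg_limit s a l"
  shows "reg_limit s (\<lambda>N. k * a N) (k * l)"
proof -
  obtain c where "(\<lambda>N. a N - c * of_nat N powr (1 - 2 * s)) \<longlonglongrightarrow> l"
    using assms unfolding reg_limit_def by blast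
  from tendsto_mult_left[OF this, of k] show ?thesis
    unfolding reg_limit_def by (intro exI[of _ "k * c"]) (simp add: algebra_simps)
qed

lemma reg_limit_diff:
  assumes "reg_limit s a l" "reg_limit s b m"
  shows "reg_limit s (\<lambda>N. a N - b N) (l - m)"
  using reg_limit_add[OF assms(1) reg_limit_cmult[OF assms(2), of "-1"]] by simp

text \<open>The difference of two values is a limit of \<open>- c * N powr (1 - 2 * s)\<close>, so
  either \<open>c = 0\<close> or the power converges, necessarily to 0. At \<open>s = 1/2\<close>
  the power is the constant 1 and could absorb any number.\<close>

lemma reg_limit_unique:
  assumes "s \<noteq> 1/2" "reg_limit s a l" "reg_limit s a m"
  shows "l = m"
proof -
  have "reg_limit s (\<lambda>N. 0) (l - m)" using reg_limit_diff[OF assms(2,3)] by simp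
  then obtain c where c: "(\<lambda>N. - (c * of_nat N powr (1 - 2 * s))) \<longlonglongrightarrow> l - m"
    unfolding reg_limit_def by auto
  show ?thesis
  proof (cases "c = 0")
    case True
    then show ?thesis using c by (simp add: LIMSEQ_const_iff)
  next
    case False
    have "(\<lambda>N. of_nat N powr (1 - 2 * s)) \<longlonglongrightarrow> (l - m) / (- c)"
      using tendsto_divide[OF c tendsto_const[of "-c"]] False by simp
    moreover have "1 - 2 * s \<noteq> 0"
      using assms(1) by (simp add: field_simps)
    ultimately have "(l - m) / (- c) = 0" by (rule of_nat_powr_convergent_imp_0)
    with False show ?thesis by simp
  qed
qed

lemma reg_limit_Suc:
  assumes "Re s > 0" "reg_limit s a l"
  shows "reg_limit s (\<lambda>N. a (Suc N)) l"
proof -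
  obtain c where c: "(\<lambda>N. a N - c * of_nat N powr (1 - 2 * s)) \<longlonglongrightarrow> l"
    using assms unfolding reg_limit_def by blast
  have "(\<lambda>N. c * ((1 + of_nat N) powr (1 - 2 * s) - of_nat N powr (1 - 2 * s))) \<longlonglongrightarrow> c * 0"
    using assms by (intro tendsto_intros powr_shift_tendsto_0) auto
  from tendsto_add[OF LIMSEQ_Suc[OF c] this] show ?thesis
    unfolding reg_limit_def by (intro exI[of _ c]) (simp add: algebra_simps)
qed

lemma reg_limit_add_nat:
  assumes "Re s > 0" "reg_limit s a l"
  shows "reg_limit s (\<lambda>N. a (N + k)) l"
proof (induction k)
  case (Suc k)
  from reg_limit_Suc[OF assms(1) Suc] show ?case by simp
qed (use assms in simp)

section \<open>Regularised Mayer sums\<close>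

text \<open>Functions on a disk are extended by 0, so the estimate is asked only at the arguments
  that occur in the sum. Keeping \<open>K\<close> as a parameter lets one constant serve a whole
  family of \<open>x\<close>.\<close>

definition Lipschitz_along :: "real \<Rightarrow> (complex \<Rightarrow> complex) \<Rightarrow> complex \<Rightarrow> bool" where
  "Lipschitz_along K F x \<longleftrightarrow> 0 < Re x \<and> 
     (\<forall>n. norm (F (1 / (x + of_nat n)) - F 0) \<le> K * norm (1 / (x + of_nat n)))"

text \<open>
  The factor \<open>1 - 2 * t\<close> makes each term entire in \<open>t\<close>: the telescoping subtrahend would otherwise be the
  primitive \<open>w powr (1 - 2 * t) / (1 - 2 * t)\<close>, and the pole at \<open>1/2\<close> now enters only in the final division.
\<close>

definition regterm :: "complex \<Rightarrow> (complex \<Rightarrow> complex) \<Rightarrow> complex \<Rightarrow> nat \<Rightarrow> complex" where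
  "regterm t F x n = (1 - 2 * t) * ((x + of_nat n) powr (- 2 * t) * F (1 / (x + of_nat n)))
     - F 0 * ((x + of_nat (Suc n)) powr (1 - 2 * t) - (x + of_nat n) powr (1 - 2 * t))"

text \<open>The subtracted \<open>F 0 * x powr (1 - 2 * t)\<close> removes the lower end of the
  telescoping part. For \<open>F\<close> constantly 1 the value is the Hurwitz zeta function at
  \<open>(2 * t, x)\<close>.\<close>

definition regsum :: "complex \<Rightarrow> (complex \<Rightarrow> complex) \<Rightarrow> complex \<Rightarrow> complex" where
  "regsum t F x = ((\<Sum>n. regterm t F x n) - F 0 * x powr (1 - 2 * t)) / (1 - 2 * t)"

definition psum :: "complex \<Rightarrow> (complex \<Rightarrow> complex) \<Rightarrow> complex \<Rightarrow> nat \<Rightarrow> complex" where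
  "psum t F x N = (\<Sum>n<N. (x + of_nat n) powr (- 2 * t) * F (1 / (x + of_nat n)))"

text \<open>Adding and subtracting \<open>(1 - 2 * t) * F 0 * w powr (- 2 * t)\<close> with
  \<open>w = x + n\<close> splits the term into one factor controlled by the Lipschitz condition and
  a Taylor remainder of \<open>w powr (1 - 2 * t)\<close>. Both have order
  \<open>n powr (- 2 * \<sigma> - 1)\<close>, with a constant that depends on \<open>t\<close> only
  through \<open>M\<close> and does not depend on \<open>x\<close>.\<close>

lemma norm_regterm_le:
  assumes "Lipschitz_along K F x" "n > 0" "\<sigma> > 0" "\<sigma> \<le> Re t" "norm t \<le> M"
  shows "norm (regterm t F x n)
    \<le> (1 + 2 * M) * (\<bar>K\<bar> + 2 * M * norm (F 0)) * exp (2 * pi * M) * real n powr (- 2 * \<sigma> - 1)"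
proof -
  define w where "w = x + of_nat n"
  define b where "b = real n powr (- 2 * \<sigma> - 1) * exp (2 * pi * M)"
  have x: "Re x > 0" and lip: "norm (F (1 / w) - F 0) \<le> K * norm (1 / w)"
    using assms unfolding Lipschitz_along_def w_def by auto
  have w: "Re w \<ge> real n" "Re w > 0" "w \<noteq> 0" using x assms unfolding w_def by (auto simp: complex_eq_iff)
  have M: "\<bar>Im t\<bar> \<le> M" "0 \<le> M" "norm (1 - 2 * t) \<le> 1 + 2 * M"
    using assms abs_Im_le_cmod[of t] norm_triangle_ineq4[of 1 "2 * t"] norm_ge_zero[of t]
    by (auto simp: norm_mult simp del: norm_ge_zero)
  have b0: "b \<ge> 0" by (simp add: b_def)
  have pw: "real n powr (- 2 * Re t - 1) * exp (pi * \<bar>2 * Im t\<bar>) \<le> b"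
    unfolding b_def using assms M
    by (intro mult_mono powr_mono) (auto simp: abs_mult)
  have nw: "norm (w powr (- 2 * t - 1)) \<le> b"
    using norm_powr_le[of "real n" w "- 2 * t - 1"] w assms pw by simp
  have 1: "norm ((1 - 2 * t) * (w powr (- 2 * t) * (F (1 / w) - F 0))) \<le> (1 + 2 * M) * \<bar>K\<bar> * b"
  proof -
    have "norm (w powr (- 2 * t)) * norm (F (1 / w) - F 0) \<le> norm (w powr (- 2 * t)) * (\<bar>K\<bar> * norm (1 / w))"
      by (intro mult_left_mono order_trans[OF lip] mult_right_mono) auto
    also have "\<dots> = \<bar>K\<bar> * norm (w powr (- 2 * t - 1))"
      using w by (simp add: powr_diff norm_divide)
    also have "\<dots> \<le> \<bar>K\<bar> * b" using nw by (intro mult_left_mono) auto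
    finally have *: "norm (w powr (- 2 * t)) * norm (F (1 / w) - F 0) \<le> \<bar>K\<bar> * b" .
    have "norm (1 - 2 * t) * (norm (w powr (- 2 * t)) * norm (F (1 / w) - F 0))
        \<le> (1 + 2 * M) * (\<bar>K\<bar> * b)"
      by (rule mult_mono[OF M(3) *]) (use M(2) in simp_all)
    then show ?thesis by (simp add: norm_mult mult.assoc)
  qed
  have 2: "norm (F 0 * ((w + 1) powr (1 - 2 * t) - w powr (1 - 2 * t) - (1 - 2 * t) * w powr (- 2 * t)))
      \<le> norm (F 0) * ((1 + 2 * M) * (2 * M) * b)"
  proof -
    have "norm ((w + 1) powr (1 - 2 * t) - w powr (1 - 2 * t) - (1 - 2 * t) * w powr (1 - 2 * t - 1))
      \<le> norm ((1 - 2 * t) * (1 - 2 * t - 1)) * (Re w powr (Re (1 - 2 * t) - 2) * exp (pi * \<bar>Im (1 - 2 * t)\<bar>))"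
      using assms w by (intro powr_Taylor) auto
    also have "\<dots> \<le> (1 + 2 * M) * (2 * M) * b"
    proof (rule mult_mono)
      show "norm ((1 - 2 * t) * (1 - 2 * t - 1)) \<le> (1 + 2 * M) * (2 * M)"
        unfolding norm_mult using M assms by (intro mult_mono) (auto simp: norm_mult)
      have "Re w powr (Re (1 - 2 * t) - 2) \<le> real n powr (- 2 * Re t - 1)"
      proof -
        have "Re (1 - 2 * t) - 2 = - 2 * Re t - 1" by simp
        then show ?thesis
          using w assms by (simp only:) (intro powr_mono2', simp_all)
      qed
      then have "Re w powr (Re (1 - 2 * t) - 2) * exp (pi * \<bar>Im (1 - 2 * t)\<bar>) 
          \<le> real n powr (- 2 * Re t - 1) * exp (pi * \<bar>2 * Im t\<bar>)"
        by (intro mult_mono) auto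
      then show "Re w powr (Re (1 - 2 * t) - 2) * exp (pi * \<bar>Im (1 - 2 * t)\<bar>) \<le> b"
        using pw by linarith
    qed (use M in auto)
    finally show ?thesis unfolding norm_mult by (intro mult_left_mono) (simp_all add: algebra_simps)
  qed
  have "regterm t F x n = (1 - 2 * t) * (w powr (- 2 * t) * (F (1 / w) - F 0)) -
     F 0 * ((w + 1) powr (1 - 2 * t) - w powr (1 - 2 * t) - (1 - 2 * t) * w powr (- 2 * t))"
    unfolding regterm_def w_def by (simp add: algebra_simps)
  also have "norm \<dots> \<le> (1 + 2 * M) * \<bar>K\<bar> * b + norm (F 0) * ((1 + 2 * M) * (2 * M) * b)"
    by (intro order_trans[OF norm_triangle_ineq4] add_mono 1 2)
  also have "\<dots> = (1 + 2 * M) * (\<bar>K\<bar> + 2 * M * norm (F 0)) * exp (2 * pi * M) * real n powr (- 2 * \<sigma> - 1)"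
    by (simp add: b_def algebra_simps)
  finally show ?thesis .
qed

text \<open>Uniformity is stated jointly in \<open>t\<close> and \<open>x\<close>: freezing
  \<open>x\<close> gives the continuation in the exponent, freezing \<open>t\<close> gives
  holomorphy in the base point.\<close>

lemma uniform_limit_regterm:
  assumes "\<sigma> > 0"
  shows "uniform_limit {(t, x). Lipschitz_along K F x \<and> \<sigma> \<le> Re t \<and> norm t \<le> M}
     (\<lambda>N (t, x). \<Sum>n<N. regterm t F x n) (\<lambda>(t, x). \<Sum>n. regterm t F x n) sequentially"
proof -
  define C where "C = (1 + 2 * M) * (\<bar>K\<bar> + 2 * M * norm (F 0)) * exp (2 * pi * M)"
  have "uniform_limit {(t, x). Lipschitz_along K F x \<and> \<sigma> \<le> Re t \<and> norm t \<le> M}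
     (\<lambda>N p. \<Sum>n<N. regterm (fst p) F (snd p) n) (\<lambda>p. \<Sum>n. regterm (fst p) F (snd p) n) sequentially"
  proof (rule Weierstrass_m_test_ev)
    show "\<forall>\<^sub>F n in sequentially. \<forall>p\<in>{(t, x). Lipschitz_along K F x \<and> \<sigma> \<le> Re t \<and> norm t \<le> M}.
       norm (regterm (fst p) F (snd p) n) \<le> C * real n powr (- 2 * \<sigma> - 1)"
      \<comment> \<open>At \<open>n = 0\<close> the majorant is 0 because
        \<open>0 powr a = 0\<close>, so the estimate is used from \<open>n = 1\<close> on.\<close>
      using eventually_gt_at_top[of 0]
    proof eventually_elim
      case (elim n)
      then show ?case unfolding C_def using assms norm_regterm_le[where n = n] by auto
    qed
    show "summable (\<lambda>n. C * real n powr (- 2 * \<sigma> - 1))"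
      using assms by (intro summable_mult) (simp add: summable_real_powr_iff)
  qed
  then show ?thesis by (simp add: case_prod_unfold)
qed

lemma sums_regterm:
  assumes "Lipschitz_along K F x" "Re t > 0"
  shows "regterm t F x sums (\<Sum>n. regterm t F x n)"
proof -
  have "(t, x) \<in> {(t', x). Lipschitz_along K F x \<and> Re t \<le> Re t' \<and> norm t' \<le> norm t}"
    using assms by auto
  from tendsto_uniform_limitI[OF uniform_limit_regterm[OF assms(2)] this]
  show ?thesis by (simp add: sums_def)
qed

lemma sum_regterm:
  "(\<Sum>n<N. regterm t F x n) =
     (1 - 2 * t) * psum t F x N - F 0 * ((x + of_nat N) powr (1 - 2 * t) - x powr (1 - 2 * t))"
proof -
  have "(\<Sum>n<N. F 0 * ((x + of_nat (Suc n)) powr (1 - 2 * t) - (x + of_nat n) powr (1 - 2 * t)))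
     = F 0 * ((x + of_nat N) powr (1 - 2 * t) - (x + of_nat 0) powr (1 - 2 * t))"
    unfolding sum_distrib_left[symmetric] by (subst sum_lessThan_telescope) simp
  then show ?thesis
    unfolding regterm_def psum_def sum_subtractf sum_distrib_left[symmetric] by simp
qed

lemma psum_minus_powr_tendsto:
  assumes "Lipschitz_along K F x" "Re t > 0" "t \<noteq> 1/2"
  shows "(\<lambda>N. psum t F x N - F 0 / (1 - 2 * t) * (x + of_nat N) powr (1 - 2 * t)) \<longlonglongrightarrow> regsum t F x"
proof -
  have t: "1 - 2 * t \<noteq> 0" using assms(3) by (simp add: field_simps)
  have "(\<lambda>N. ((\<Sum>n<N. regterm t F x n) - F 0 * x powr (1 - 2 * t)) / (1 - 2 * t)) \<longlonglongrightarrow> regsum t F x"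
    unfolding regsum_def using sums_regterm[OF assms(1,2)]
    by (intro tendsto_intros t) (simp add: sums_def)
  then show ?thesis
    unfolding sum_regterm by (rule Lim_transform_eventually) (use t in \<open>auto simp: field_simps\<close>)
qed

text \<open>Replacing \<open>(x + N) powr (1 - 2 * t)\<close> by \<open>N powr (1 - 2 * t)\<close>
  gives one normalisation for all base points, so that sums with different \<open>x\<close> can be
  compared.\<close>

lemma reg_limit_psum:
  assumes "Lipschitz_along K F x" "Re t > 0" "t \<noteq> 1/2"
  shows "reg_limit t (psum t F x) (regsum t F x)"
proof -
  define c where "c = F 0 / (1 - 2 * t)"
  have x: "Re x > 0" using assms unfolding Lipschitz_along_def by simp
  have "(\<lambda>N. c * ((x + of_nat N) powr (1 - 2 * t) - of_nat N powr (1 - 2 * t))) \<longlonglongrightarrow> c * 0"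
    using assms x by (intro tendsto_intros powr_shift_tendsto_0) auto
  from tendsto_add[OF psum_minus_powr_tendsto[OF assms] this]
  show ?thesis unfolding reg_limit_def
    by (intro exI[of _ c]) (simp add: algebra_simps c_def)
qed

lemma sums_regsum:
  assumes "Lipschitz_along K F x" "Re t > 1/2"
  shows "(\<lambda>n. (x + of_nat n) powr (- 2 * t) * F (1 / (x + of_nat n))) sums regsum t F x"
proof -
  have t: "t \<noteq> 1/2" "Re t > 0"
    using assms(2) by (metis Re_complex_of_real of_real_1 of_real_divide of_real_numeral less_irrefl) (use assms(2) in simp)
  define c where "c = F 0 / (1 - 2 * t)"
  have x: "Re x > 0" using assms unfolding Lipschitz_along_def by simp
  have "(\<lambda>N. (x + of_nat N) powr (1 - 2 * t) - of_nat N powr (1 - 2 * t)) \<longlonglongrightarrow> 0"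
    using assms x by (intro tendsto_intros powr_shift_tendsto_0) auto
  moreover have "(\<lambda>N. of_nat N powr (1 - 2 * t)) \<longlonglongrightarrow> 0"
    using assms by (intro tendsto_neg_powr_complex_of_nat filterlim_ident) auto
  ultimately have "(\<lambda>N. (x + of_nat N) powr (1 - 2 * t) - of_nat N powr (1 - 2 * t)
      + of_nat N powr (1 - 2 * t)) \<longlonglongrightarrow> 0 + 0"
    by (rule tendsto_add)
  from tendsto_add[OF psum_minus_powr_tendsto[OF assms(1) t(2,1)] tendsto_mult_left[OF this, of c]]
  show ?thesis unfolding sums_def psum_def by (simp add: c_def)
qed

text \<open>The series of regularised terms converges locally uniformly in \<open>t\<close> on the
  right half-plane, so the numerator of \<open>regsum\<close> is holomorphic there; the division by
  \<open>1 - 2 * t\<close> is the only source of a pole. To the right of \<open>1/2\<close> the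
  subtracted power tends to 0 and the original series remains.\<close>

lemma is_continuation_regsum:
  assumes "Lipschitz_along K F x"
  shows "is_continuation (\<lambda>t. \<Sum>n. (x + of_nat n) powr (- 2 * t) * F (1 / (x + of_nat n)))
           (\<lambda>t. regsum t F x)"
proof -
  have x: "Re x > 0" using assms unfolding Lipschitz_along_def by simp
  have x0: "x \<noteq> 0" using x by auto
  have "(\<lambda>t. \<Sum>n. regterm t F x n) holomorphic_on {t. 0 < Re t}"
  proof (rule holomorphic_uniform_sequence)
    show "open {t. 0 < Re t}" by (rule open_halfspace_Re_gt)
    show "(\<lambda>t. \<Sum>n<N. regterm t F x n) holomorphic_on {t. 0 < Re t}" for N
      unfolding regterm_def by (intro holomorphic_intros)
    fix t assume t: "t \<in> {t. 0 < Re t}"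
    \<comment> \<open>On \<open>cball t d\<close> the real part is at least
      \<open>Re t - d = d\<close>, which serves as the lower bound \<sigma>.\<close>
    define d where "d = Re t / 2"
    have d: "d > 0" using t by (simp add: d_def)
    have *: "d \<le> Re u" "norm u \<le> norm t + d" if "u \<in> cball t d" for u
      using that abs_Re_le_cmod[of "t - u"] norm_triangle_ineq[of t "u - t"]
      by (auto simp: dist_norm d_def norm_minus_commute)
    have "uniform_limit (cball t d) (\<lambda>N u. \<Sum>n<N. regterm u F x n) (\<lambda>u. \<Sum>n. regterm u F x n) sequentially"
      using uniform_limit_compose'[OF uniform_limit_regterm[OF d, of F K "norm t + d"], where B = "cball t d" and h = "\<lambda>u. (u, x)"] * assms
      by auto
    then show "\<exists>d>0. cball t d \<subseteq> {t. 0 < Re t} \<and>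
        uniform_limit (cball t d) (\<lambda>N u. \<Sum>n<N. regterm u F x n) (\<lambda>u. \<Sum>n. regterm u F x n) sequentially"
      using d * by (intro exI[of _ d]) force
  qed
  then have num: "(\<lambda>t. (\<Sum>n. regterm t F x n) - F 0 * x powr (1 - 2 * t)) holomorphic_on {t. 0 < Re t}"
    by (intro holomorphic_intros)
  have "(\<lambda>t. regsum t F x) meromorphic_on {t. 0 < Re t}"
    unfolding regsum_def using num
    by (intro meromorphic_intros analytic_on_imp_meromorphic_on)
       (auto simp: analytic_on_open open_halfspace_Re_gt intro!: holomorphic_intros)
  moreover have "(\<lambda>t. regsum t F x) holomorphic_on {t. 0 < Re t} - {1/2}"
    unfolding regsum_def
    by (intro holomorphic_on_divide holomorphic_on_subset[OF num] holomorphic_intros) (auto simp: field_simps)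
  moreover have "regsum t F x = (\<Sum>n. (x + of_nat n) powr (- 2 * t) * F (1 / (x + of_nat n)))"
    if "Re t > 1/2" for t
    using sums_unique[OF sums_regsum[OF assms that]] .
  ultimately show ?thesis unfolding is_continuation_def by blast
qed

lemma is_continuation_add:
  assumes "is_continuation g h" "is_continuation g' h'"
  shows "is_continuation (\<lambda>t. g t + g' t) (\<lambda>t. h t + h' t)"
  using assms unfolding is_continuation_def
  by (auto intro!: meromorphic_intros holomorphic_intros)

lemma holomorphic_regsum:
  assumes "open D" "\<And>x. x \<in> D \<Longrightarrow> Lipschitz_along K F x" "F holomorphic_on V" 
    "\<And>x n. x \<in> D \<Longrightarrow> 1 / (x + of_nat n) \<in> V" and t: "Re t > 0"
  shows "regsum t F holomorphic_on D"
proof -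
  have pos: "Re x > 0" if "x \<in> D" for x using assms(2)[OF that] unfolding Lipschitz_along_def by simp
  have nr: "x + of_nat n \<notin> \<real>\<^sub>\<le>\<^sub>0" "x + of_nat n \<noteq> 0" if "x \<in> D" for x n
    using pos[OF that] not_nonpos_Reals[of "x + of_nat n"] by (auto simp: complex_eq_iff)
  have F: "(\<lambda>x. F (1 / (x + of_nat n))) holomorphic_on D" for n
    using assms(4) nr
    by (intro holomorphic_on_compose_gen[OF _ assms(3), unfolded o_def] holomorphic_intros) auto
  have "(\<lambda>x. \<Sum>n. regterm t F x n) holomorphic_on D"
  proof (rule holomorphic_uniform_sequence[OF assms(1)])
    show "(\<lambda>x. \<Sum>n<N. regterm t F x n) holomorphic_on D" for N
      unfolding regterm_def using nr[of _ "Suc _"] by (intro holomorphic_intros F) (use nr in auto)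
    fix x assume "x \<in> D"
    then obtain d where d: "d > 0" "cball x d \<subseteq> D"
      using assms(1) open_contains_cball by blast
    have "uniform_limit (cball x d) (\<lambda>N x. \<Sum>n<N. regterm t F x n) (\<lambda>x. \<Sum>n. regterm t F x n) sequentially"
      using uniform_limit_compose'[OF uniform_limit_regterm[OF t, of F K "norm t"], where B = "cball x d" and h = "\<lambda>u. (t, u)"] assms(2) d
      by auto
    then show "\<exists>d>0. cball x d \<subseteq> D \<and>
        uniform_limit (cball x d) (\<lambda>N x. \<Sum>n<N. regterm t F x n) (\<lambda>x. \<Sum>n. regterm t F x n) sequentially"
      using d by blast
  qed
  \<comment> \<open>At \<open>t = 1/2\<close> division by zero makes \<open>regsum\<close>
    constantly 0, which is holomorphic too.\<close>
  then show ?thesis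
    unfolding regsum_def[abs_def] using nr[of _ 0]
    by (cases "1 - 2 * t = 0") (auto intro!: holomorphic_intros)
qed

section \<open>The transfer operators as regularised sums\<close>

lemma Lipschitz_along_add_nat:
  assumes "Lipschitz_along K F x"
  shows "Lipschitz_along K F (x + of_nat k)"
  unfolding Lipschitz_along_def
proof (intro conjI allI)
  show "0 < Re (x + of_nat k)" using assms unfolding Lipschitz_along_def by simp
  show "norm (F (1 / (x + of_nat k + of_nat n)) - F 0) \<le> K * norm (1 / (x + of_nat k + of_nat n))" for n
    using assms unfolding Lipschitz_along_def by (metis add.assoc of_nat_add)
qed

text \<open>Both sides are regularised limits of the partial sums with index \<open>N + k\<close>,
  and such limits are unique.\<close>

lemma regsum_add_nat:
  assumes "Re s > 0" "s \<noteq> 1/2" "Lipschitz_along K F x"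
  shows "regsum s F x = psum s F x k + regsum s F (x + of_nat k)"
proof -
  have *: "psum s F x (N + k) = psum s F x k + psum s F (x + of_nat k) N" for N
    unfolding psum_def by (induction N) (simp_all add: add_ac)
  have "reg_limit s (\<lambda>N. psum s F x (N + k)) (regsum s F x)"
    by (intro reg_limit_add_nat reg_limit_psum[OF assms(3)] assms(1,2))
  moreover have "reg_limit s (\<lambda>N. psum s F x k + psum s F (x + of_nat k) N)
      (psum s F x k + regsum s F (x + of_nat k))"
    by (intro reg_limit_add reg_limit_tendsto[OF tendsto_const]
          reg_limit_psum[OF Lipschitz_along_add_nat[OF assms(3)]] assms(1,2))
  ultimately show ?thesis
    unfolding * using reg_limit_unique[OF assms(2)] by blast
qed

lemma regsum_rec:
  assumes "Re s > 0" "s \<noteq> 1/2" "Lipschitz_along K F x"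
  shows "regsum s F x = x powr (- 2 * s) * F (1 / x) + regsum s F (x + 1)"
  using regsum_add_nat[OF assms, of 1] by (simp add: psum_def)

text \<open>The tails may fail to tend to 0 when \<open>Re s \<le> 1/2\<close>; they vanish only up
  to a multiple of \<open>N powr (1 - 2 * s)\<close>, which is all that telescoping
  requires.\<close>

lemma reg_limit_regsum_tail:
  assumes "Re s > 0" "s \<noteq> 1/2" "Lipschitz_along K F x"
  shows "reg_limit s (\<lambda>N. regsum s F (x + of_nat N)) 0"
proof -
  have "regsum s F (x + of_nat N) = regsum s F x - psum s F x N" for N
    using regsum_add_nat[OF assms, of N] by simp
  moreover have "reg_limit s (\<lambda>N. regsum s F x - psum s F x N) (regsum s F x - regsum s F x)"
    by (intro reg_limit_diff reg_limit_psum[OF assms(3)] reg_limit_tendsto[OF tendsto_const] assms(1,2))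
  ultimately show ?thesis by simp
qed

text \<open>The partial sums are \<open>G 0 - G N\<close>, whose regularised limit is
  \<open>G 0\<close>. Every continued sum of the correspondence is evaluated this way, without
  returning to the half-plane of convergence.\<close>

lemma regsum_telescope:
  assumes "Re s > 0" "s \<noteq> 1/2" "Lipschitz_along K F x"
    and G: "\<And>n. (x + of_nat n) powr (- 2 * s) * F (1 / (x + of_nat n)) = G n - G (Suc n)"
    and lim: "reg_limit s G 0"
  shows "regsum s F x = G 0"
proof -
  have "psum s F x N = G 0 - G N" for N
    unfolding psum_def G by (induction N) auto
  then have "psum s F x = (\<lambda>N. G 0 - G N)" by (intro ext)
  then have "reg_limit s (\<lambda>N. G 0 - G N) (regsum s F x)"
    using reg_limit_psum[OF assms(3,1,2)] by simp
  moreover have "reg_limit s (\<lambda>N. G 0 - G N) (G 0 - 0)"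
    by (intro reg_limit_diff lim reg_limit_tendsto[OF tendsto_const])
  ultimately show ?thesis using reg_limit_unique[OF assms(2)] by fastforce
qed

lemma regsum_linear:
  assumes "Re s > 0" "Lipschitz_along K F x" "Lipschitz_along K' G x"
  shows "regsum s (\<lambda>u. a * F u + b * G u) x = a * regsum s F x + b * regsum s G x"
proof -
  have "regterm s (\<lambda>u. a * F u + b * G u) x n = a * regterm s F x n + b * regterm s G x n" for n
    unfolding regterm_def by (simp add: algebra_simps)
  moreover have "(\<lambda>n. a * regterm s F x n + b * regterm s G x n) sums
      (a * (\<Sum>n. regterm s F x n) + b * (\<Sum>n. regterm s G x n))"
    by (intro sums_add sums_mult sums_regterm[OF assms(2,1)] sums_regterm[OF assms(3,1)])
  ultimately have "(\<Sum>n. regterm s (\<lambda>u. a * F u + b * G u) x n) =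
      a * (\<Sum>n. regterm s F x n) + b * (\<Sum>n. regterm s G x n)"
    by (simp add: sums_unique[symmetric])
  then show ?thesis unfolding regsum_def
    by (simp add: add_divide_distrib diff_divide_distrib algebra_simps)
qed

section \<open>Lipschitz bounds for functions on the two disks\<close>

lemma disk_algebra_Lipschitz:
  assumes "f \<in> disk_algebra a r" "0 \<in> ball a r"
  obtains K where "\<And>u. u \<in> cball a r \<Longrightarrow> norm (f u - f 0) \<le> K * norm u"
proof -
  have f: "continuous_on (cball a r) f" "f holomorphic_on ball a r"
    using assms(1) unfolding disk_algebra_def by auto
  have "(f has_field_derivative deriv f 0) (at 0)"
    using f(2) assms(2) by (intro holomorphic_derivI[where S = "ball a r"]) auto
  then obtain g where g: "\<And>z. f z - f 0 = g z * (z - 0)" "isCont g 0"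
    unfolding CARAT_DERIV by blast
  have "\<forall>\<^sub>F z in at 0. dist (g z) (g 0) < 1"
    using g(2) by (intro tendstoD) (auto simp: isCont_def)
  then obtain d where d: "d > 0" "\<And>z. z \<noteq> 0 \<Longrightarrow> dist z 0 < d \<Longrightarrow> dist (g z) (g 0) < 1"
    unfolding eventually_at by auto
  obtain M where M: "\<And>u. u \<in> cball a r \<Longrightarrow> norm (f u) \<le> M"
    using compact_imp_bounded[OF compact_continuous_image[OF f(1) compact_cball]]
    unfolding bounded_iff by (metis imageI)
  have M0: "M \<ge> 0" "norm (f 0) \<le> M" using M[of 0] assms(2) order_trans[OF norm_ge_zero M[of 0]] by auto
  \<comment> \<open>Near 0 the Caratheodory quotient \<open>g\<close> is bounded by
    \<open>norm (g 0) + 1\<close>; at distance at least \<open>d\<close> from 0 the trivial bound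
    \<open>2 * M\<close> is at most \<open>2 * M / d * norm u\<close>.\<close>
  define K where "K = norm (g 0) + 1 + 2 * M / d"
  have K: "K \<ge> norm (g 0) + 1" "K \<ge> 2 * M / d" "K \<ge> 0"
    using M0 d by (auto simp: K_def)
  have "norm (f u - f 0) \<le> K * norm u" if u: "u \<in> cball a r" for u
  proof (cases "norm u < d")
    case True
    have "norm (g u) \<le> K"
    proof (cases "u = 0")
      case False
      have "norm (g u) \<le> norm (g 0) + dist (g u) (g 0)"
        by (metis dist_norm norm_triangle_sub)
      with d(2)[OF False] True K show ?thesis by simp
    qed (use K in simp)
    then show ?thesis unfolding g(1) norm_mult by (auto intro: mult_right_mono)
  next
    case False
    have "norm (f u - f 0) \<le> 2 * M"
      using M[OF u] M0(2) norm_triangle_ineq4[of "f u" "f 0"] by linarith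
    also have "\<dots> = 2 * M / d * d" using d by simp
    also have "\<dots> \<le> K * norm u" using K False d M0 by (intro mult_mono) auto
    finally show ?thesis .
  qed
  then show ?thesis using that by blast
qed

lemma unit_disk_Lipschitz_along:
  assumes "h \<in> disk_algebra 0 1"
  obtains K where "\<And>x. Re x \<ge> 1 \<Longrightarrow> Lipschitz_along K h x"
proof -
  obtain K where K: "\<And>u. u \<in> cball 0 1 \<Longrightarrow> norm (h u - h 0) \<le> K * norm u"
    using disk_algebra_Lipschitz[OF assms] by auto
  have "1 / (x + of_nat n) \<in> cball 0 1" if "Re x \<ge> 1" for x n
    using that complex_Re_le_cmod[of "x + of_nat n"] by (auto simp: norm_divide divide_le_eq_1)
  then have "Lipschitz_along K h x" if "Re x \<ge> 1" for x
    using that K unfolding Lipschitz_along_def by auto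
  then show ?thesis using that by blast
qed

text \<open>Inversion maps this half-plane onto the open disk with diameter from 0 to
  \<open>5/2\<close>. That disk touches Mayer's disk from inside at \<open>5/2\<close>, hence the
  bound \<open>2/5\<close>.\<close>

lemma inverse_in_mayer_ball:
  assumes "Re w > 2/5"
  shows "1 / w \<in> ball 1 (3/2)"
proof -
  have w: "w \<noteq> 0" using assms by auto
  have "(2 / 5) ^ 2 < (Re w)\<^sup>2" using assms by (intro power_strict_mono) auto
  then have "4 / 25 < (Re w)\<^sup>2" by (simp add: power2_eq_square)
  moreover have "(Re w - 1)\<^sup>2 = (Re w)\<^sup>2 - 2 * Re w + 1" by (simp add: power2_diff)
  ultimately have "(Re w - 1)\<^sup>2 + (Im w)\<^sup>2 < 9 / 4 * ((Re w)\<^sup>2 + (Im w)\<^sup>2)"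
    using assms zero_le_power2[of "Im w"] unfolding distrib_left by linarith
  moreover have "(3 / 2 * norm w)\<^sup>2 = 9 / 4 * ((Re w)\<^sup>2 + (Im w)\<^sup>2)"
    unfolding power_mult_distrib cmod_power2 by (simp add: power2_eq_square)
  ultimately have "(norm (w - 1))\<^sup>2 < (3/2 * norm w)\<^sup>2"
    unfolding cmod_power2[of "w - 1"] by simp
  then have "norm (w - 1) < 3/2 * norm w" by (rule power2_less_imp_less) simp
  moreover have "1 - 1 / w = (w - 1) / w" using w by (simp add: field_simps)
  ultimately show ?thesis using w by (simp add: dist_norm norm_divide field_simps)
qed

lemma mayer_Lipschitz_along:
  assumes "f \<in> disk_algebra 1 (3/2)"
  obtains K where "\<And>x. Re x > 2/5 \<Longrightarrow> Lipschitz_along K f x"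
proof -
  obtain K where K: "\<And>u. u \<in> cball 1 (3/2) \<Longrightarrow> norm (f u - f 0) \<le> K * norm u"
    using disk_algebra_Lipschitz[OF assms] by auto
  have "1 / (x + of_nat n) \<in> cball 1 (3/2)" if "Re x > 2/5" for x n
    using inverse_in_mayer_ball[of "x + of_nat n"] that by auto
  then have "Lipschitz_along K f x" if "Re x > 2/5" for x
    using that K unfolding Lipschitz_along_def by auto
  then show ?thesis using that by blast
qed

section \<open>Evaluation of the operators on their disks\<close>

lemma cball_Re_ge: "z \<in> cball a r \<Longrightarrow> Re a - r \<le> Re z"
  using abs_Re_le_cmod[of "a - z"] by (simp add: dist_norm)

lemma cball_Re_le: "z \<in> cball a r \<Longrightarrow> Re z \<le> Re a + r"
  using abs_Re_le_cmod[of "a - z"] by (simp add: dist_norm)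

lemma mayer_op_eq:
  assumes "Re s > 0" "s \<noteq> 1/2" "f \<in> mayer_space" "z \<in> cball 1 (3/2)"
  shows "mayer_op s f z = regsum s f (z + 1)"
proof -
  obtain K where "\<And>x. Re x > 2/5 \<Longrightarrow> Lipschitz_along K f x"
    using mayer_Lipschitz_along assms(3) unfolding mayer_space_def by blast
  then have "Lipschitz_along K f (z + 1)" using cball_Re_ge[OF assms(4)] by simp
  from continuation_eq[OF is_continuation_regsum[OF this] assms(1,2)]
  show ?thesis using assms(4) unfolding mayer_op_def by (simp add: add_ac)
qed

lemma disk_algebra_uminus:
  assumes "f \<in> disk_algebra 0 r"
  shows "(\<lambda>u. f (- u)) \<in> disk_algebra 0 r"
proof -
  have f: "continuous_on (cball 0 r) f" "f holomorphic_on ball 0 r"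
    using assms unfolding disk_algebra_def by auto
  have "continuous_on (cball 0 r) (\<lambda>u. f (- u))"
    by (rule continuous_on_compose2[OF f(1)]) (auto intro!: continuous_intros)
  moreover have "(\<lambda>u. f (- u)) holomorphic_on ball 0 r"
    by (rule holomorphic_on_compose_gen[OF _ f(2), unfolded o_def]) (auto intro!: holomorphic_intros)
  ultimately show ?thesis using assms unfolding disk_algebra_def by simp
qed

text \<open>Reflecting the first component turns its argument \<open>-1 / w\<close> into
  \<open>1 / w\<close>, so all four series become Mayer sums. On the unit disk their base points
  have real part at least 1.\<close>

lemma nearest_op_eq:
  assumes "Re s > 0" "s \<noteq> 1/2" "f \<in> disk_algebra 0 1" "g \<in> disk_algebra 0 1" "z \<in> cball 0 1"
  shows "fst (nearest_op s (f, g)) z = regsum s (\<lambda>u. f (- u)) (3 + z) + regsum s g (2 - z)"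
    and "snd (nearest_op s (f, g)) z = regsum s (\<lambda>u. f (- u)) (2 + z) + regsum s g (3 - z)"
proof -
  obtain K where K: "\<And>x. Re x \<ge> 1 \<Longrightarrow> Lipschitz_along K (\<lambda>u. f (- u)) x"
    using unit_disk_Lipschitz_along disk_algebra_uminus[OF assms(3)] by blast
  obtain K' where K': "\<And>x. Re x \<ge> 1 \<Longrightarrow> Lipschitz_along K' g x"
    using unit_disk_Lipschitz_along assms(4) by blast
  have z: "- 1 \<le> Re z" "Re z \<le> 1" using cball_Re_ge[OF assms(5)] cball_Re_le[OF assms(5)] by auto
  have *: "is_continuation (\<lambda>t. (\<Sum>n. (a + of_nat n) powr (- 2 * t) * f (- (1 / (a + of_nat n)))) +
      (\<Sum>n. (b + of_nat n) powr (- 2 * t) * g (1 / (b + of_nat n))))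
      (\<lambda>t. regsum t (\<lambda>u. f (- u)) a + regsum t g b)" if "Re a \<ge> 1" "Re b \<ge> 1" for a b
    using is_continuation_add[OF is_continuation_regsum[OF K[OF that(1)]] is_continuation_regsum[OF K'[OF that(2)]]] .
  show "fst (nearest_op s (f, g)) z = regsum s (\<lambda>u. f (- u)) (3 + z) + regsum s g (2 - z)"
    using continuation_eq[OF *[of "3 + z" "2 - z"] assms(1,2)] z assms(5)
    by (simp add: nearest_op_def algebra_simps)
  show "snd (nearest_op s (f, g)) z = regsum s (\<lambda>u. f (- u)) (2 + z) + regsum s g (3 - z)"
    using continuation_eq[OF *[of "2 + z" "3 - z"] assms(1,2)] z assms(5)
    by (simp add: nearest_op_def algebra_simps)
qed

section \<open>The hyperbolic cocycle equation\<close>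

text \<open>Two arguments of modulus below \<open>pi / 2\<close> add up to less than
  \<open>pi\<close>, so the principal logarithm is additive here.\<close>

lemma powr_mult_Re_pos:
  fixes a b q :: complex
  assumes "Re a > 0" "Re b > 0"
  shows "(a * b) powr q = a powr q * b powr q"
proof -
  have ab: "a \<noteq> 0" "b \<noteq> 0" using assms by auto
  then have "\<bar>Im (Ln a)\<bar> < pi / 2" "\<bar>Im (Ln b)\<bar> < pi / 2"
    using assms Re_Ln_pos_lt by blast+
  then have "Ln (a * b) = Ln a + Ln b"
    using ab by (intro Ln_times_simple) auto
  then show ?thesis using ab by (simp add: powr_def distrib_left exp_add)
qed

lemma Re_inverse_pos: "Re w > 0 \<Longrightarrow> Re (1 / w) > 0"
  by (simp add: Re_divide sum_power2_gt_zero_iff)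

text \<open>The hyperbolic Moebius map with attracting fixed point \<open>phi - 1\<close> and
  repelling fixed point \<open>-phi\<close>. It is the square of the map sending \<open>z\<close> to
  \<open>1 / (z + 1)\<close>.\<close>

definition kap :: "complex \<Rightarrow> complex" where
  "kap z = (z + 1) / (z + 2)"

text \<open>Since \<open>kap z = 1 - 1 / (z + 2)\<close>, the half-plane
  \<open>Re (z + 2) \<ge> c\<close> goes to the disk with diameter from \<open>1 - 1 / c\<close> to
  1.\<close>

lemma kap_in_cball:
  assumes "c > 0" "Re z \<ge> c - 2"
  shows "kap z \<in> cball (of_real (1 - 1 / (2 * c))) (1 / (2 * c))"
proof -
  define w where "w = z + 2"
  have w: "Re w \<ge> c" "w \<noteq> 0" using assms by (auto simp: w_def complex_eq_iff)
  \<comment> \<open>The half-plane \<open>Re w \<ge> c\<close> consists of the points at least as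
    close to \<open>2 * c\<close> as to 0.\<close>
  have "norm (2 * c - w) ^ 2 \<le> norm w ^ 2"
    unfolding cmod_power2 using w(1) assms(1) 
      mult_left_mono[OF w(1), of "4 * c"] by (simp add: power2_eq_square algebra_simps)
  then have "norm (2 * of_real c - w) \<le> norm w"
    using power2_le_imp_le[OF _ norm_ge_zero] by simp
  moreover have "of_real (1 - 1 / (2 * c)) - kap z = (2 * of_real c - w) / (2 * of_real c * w)"
    using w(2) assms(1) unfolding kap_def w_def by (simp add: field_simps add_eq_0_iff)
  ultimately have "norm (of_real (1 - 1 / (2 * c)) - kap z) \<le> norm w / norm (2 * of_real c * w)"
    by (simp only: norm_divide divide_right_mono norm_ge_zero)
  also have "\<dots> = 1 / (2 * c)" using w(2) assms(1) by (simp add: norm_mult)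
  finally show ?thesis by (simp only: mem_cball dist_norm)
qed

lemma kap_in_cball_half: "Re z \<ge> -1 \<Longrightarrow> kap z \<in> cball (1/2) (1/2)"
  using kap_in_cball[of 1 z] by simp

definition phi :: real where
  "phi = (1 + sqrt 5) / 2"

text \<open>The half-plane \<open>Re z > - 8 / 5\<close> used below lies to the right of the
  repelling fixed point \<open>-phi\<close>, so powers of \<open>z + phi\<close> are holomorphic on
  it. The number \<open>8/5\<close> is \<open>2 - 2/5\<close>, with \<open>2/5\<close> from Mayer's
  disk.\<close>

lemma phi_gt: "phi > 8 / 5"
proof -
  have "11 / 5 < sqrt 5" by (rule real_less_rsqrt) (simp add: power2_eq_square)
  then show ?thesis by (simp add: phi_def)
qed

lemma phi_square: "complex_of_real phi * of_real phi = of_real phi + 1"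
proof -
  have "phi * phi = phi + 1"
    by (simp add: phi_def field_simps)
  then show ?thesis by (metis of_real_1 of_real_add of_real_mult)
qed

lemma Re_add_phi_pos: "Re z \<ge> - 8 / 5 \<Longrightarrow> Re (z + phi) > 0"
  using phi_gt by simp

text \<open>For \<open>c = 2/5\<close> the image disk has diameter from \<open>-3/2\<close> to 1, so
  \<open>kap\<close> maps the half-plane \<open>Re z > - 8 / 5\<close> into a compact part of
  itself.\<close>

lemma kap_Re: "Re z > - 8 / 5 \<Longrightarrow> Re (kap z) \<ge> - 3 / 2"
  using cball_Re_ge[OF kap_in_cball[of "2/5" z]] by simp

text \<open>The weight \<open>(z + 2) powr (- 2 * s)\<close> at the attracting fixed point
  \<open>phi - 1\<close>, where \<open>z + 2 = phi\<^sup>2\<close>.\<close>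

definition kap_factor :: "complex \<Rightarrow> complex" where
  "kap_factor s = complex_of_real phi powr (- 4 * s)"

lemma norm_kap_factor: 
  assumes "Re s > 0"
  shows "norm (kap_factor s) < 1"
proof -
  have "norm (kap_factor s) = phi powr (- 4 * Re s)"
    unfolding kap_factor_def using phi_gt by (subst norm_powr_real_powr) auto
  also have "\<dots> < phi powr 0" using phi_gt assms by (intro powr_less_mono) auto
  finally show ?thesis using phi_gt by simp
qed

text \<open>
  The weight of \<^const>\<open>kap\<close> is cohomologous to a constant: \<open>-phi\<close> is its repelling fixed
  point, so that \<open>(z + 2) * (kap z + phi) = phi\<^sup>2 * (z + phi)\<close>.
\<close>

lemma kap_weight:
  assumes "Re z > - 8 / 5"
  shows "(z + phi) powr (2 * s) * (z + 2) powr (- 2 * s) = kap_factor s * (kap z + phi) powr (2 * s)"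
proof -
  have pos: "Re (kap z + phi) > 0" "Re (z + 2) > 0" "Re (z + phi) > 0" "Re (complex_of_real phi) > 0"
    using assms kap_Re[OF assms] phi_gt by auto
  have z2: "z + 2 \<noteq> 0" using pos(2) by (metis zero_complex.sel(1) less_irrefl)
  have "(z + 2) * (kap z + phi) = z + 1 + (z + 2) * phi"
    using z2 by (simp add: kap_def field_simps)
  \<comment> \<open>Here \<open>phi\<^sup>2 = phi + 1\<close> is applied to both coefficients, the
    second being \<open>phi\<^sup>2 * phi = 2 * phi + 1\<close>.\<close>
  also have "\<dots> = (complex_of_real phi * phi) * z + (complex_of_real phi * phi) * phi"
    unfolding phi_square distrib_right[of "complex_of_real phi" 1 phi] by (simp add: algebra_simps)
  finally have "(z + 2) * (kap z + phi) = phi * (phi * (z + phi))" by (simp add: algebra_simps)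
  moreover have "((z + 2) * (kap z + phi)) powr (2 * s) = (z + 2) powr (2 * s) * (kap z + phi) powr (2 * s)"
    by (intro powr_mult_Re_pos pos)
  moreover have "(phi * (phi * (z + phi))) powr (2 * s) = complex_of_real phi powr (2 * s) * (complex_of_real phi powr (2 * s) * (z + phi) powr (2 * s))"
  proof -
    have "Re (phi * (z + phi)) > 0" using pos by (simp del: plus_complex.sel)
    then show ?thesis
      using powr_mult_Re_pos[OF pos(4) \<open>Re (phi * (z + phi)) > 0\<close>] powr_mult_Re_pos[OF pos(4,3)] by simp
  qed
  ultimately have "(z + 2) powr (2 * s) * (kap z + phi) powr (2 * s) =
      complex_of_real phi powr (2 * s) * (complex_of_real phi powr (2 * s) * (z + phi) powr (2 * s))" by simp
  moreover have "complex_of_real phi powr (2 * s) * complex_of_real phi powr (2 * s) * kap_factor s = 1"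
    using pos(4) unfolding kap_factor_def powr_add[symmetric] by auto
  moreover have "(z + 2) powr (- 2 * s) * (z + 2) powr (2 * s) = 1"
    using z2 unfolding powr_add[symmetric] by simp
  ultimately show ?thesis by algebra
qed

text \<open>Multiplication by \<open>(z + phi) powr (2 * s)\<close> turns the weight into the
  constant \<open>kap_factor s\<close>, of modulus below 1. Iteration then bounds the function by
  arbitrarily small multiples of its maximum on a compact disk.\<close>

lemma kap_invariant_imp_0:
  assumes "Re s > 0" "S \<subseteq> {z. Re z > -1}" "cball (1/2) (1/2) \<subseteq> S" 
    and cont: "continuous_on (cball (1/2) (1/2)) E"
    and inv: "\<And>z. z \<in> S \<Longrightarrow> E z = (z + 2) powr (- 2 * s) * E (kap z)" and "z \<in> S"
  shows "E z = 0"
proof -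
  define E' where "E' = (\<lambda>z::complex. (z + phi) powr (2 * s) * E z)"
  have nz: "z + phi \<notin> \<real>\<^sub>\<le>\<^sub>0" if "Re z > -1" for z
    using that by (intro not_nonpos_Reals Re_add_phi_pos) simp
  have inv': "E' z = kap_factor s * E' (kap z)" if "z \<in> S" for z
  proof -
    have "Re z > - 8 / 5" using that assms(2) by auto
    from kap_weight[OF this, of s] show ?thesis
      unfolding E'_def using inv[OF that] by (simp add: mult_ac)
  qed
  have kap: "kap z \<in> cball (1/2) (1/2)" if "z \<in> S" for z
    using that assms(2) by (intro kap_in_cball_half) auto
  have "continuous_on (cball (1/2) (1/2)) E'"
    unfolding E'_def using nz assms(2,3)
    by (intro continuous_on_mult[OF holomorphic_on_imp_continuous_on cont] holomorphic_intros) blast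
  from compact_imp_bounded[OF compact_continuous_image[OF this compact_cball]]
  obtain M where M: "\<And>z. z \<in> cball (1/2) (1/2) \<Longrightarrow> norm (E' z) \<le> M"
    unfolding bounded_iff by (metis imageI)
  \<comment> \<open>The exponent is \<open>Suc k\<close> because the bound \<open>M\<close> holds on
    the disk, which is reached only after one application of \<open>kap\<close>.\<close>
  have bound: "norm (E' z) \<le> norm (kap_factor s) ^ Suc k * M" if "z \<in> S" for z k
    using that
  proof (induction k arbitrary: z)
    case 0
    show ?case using inv'[OF 0] M[OF kap[OF 0]] by (simp add: norm_mult mult_left_mono)
  next
    case (Suc k)
    have "kap z \<in> S" using kap[OF Suc.prems] assms(3) by blast
    from Suc.IH[OF this] show ?case
      using inv'[OF Suc.prems] by (simp add: norm_mult mult.assoc mult_left_mono)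
  qed
  have "(\<lambda>k. norm (kap_factor s) ^ Suc k * M) \<longlonglongrightarrow> 0 * M"
    using norm_kap_factor[OF assms(1)] by (intro tendsto_intros LIMSEQ_Suc LIMSEQ_power_zero) auto
  then have "norm (E' z) \<le> 0 * M"
    by (rule LIMSEQ_le_const) (use bound[OF \<open>z \<in> S\<close>] in auto)
  then show ?thesis using nz[of z] assms(2) \<open>z \<in> S\<close> by (auto simp: E'_def)
qed

text \<open>After conjugation by \<open>(z + phi) powr (2 * s)\<close> the equation reads
  \<open>B' z = G' z + q * B' (kap z)\<close> with \<open>norm q < 1\<close>, and the geometric
  series along the orbit of \<open>kap\<close> solves it.\<close>

lemma kap_Neumann:
  assumes s: "Re s > 0" and G: "G holomorphic_on {z. Re z > - 8 / 5}"
  obtains B where "B holomorphic_on {z. Re z > - 8 / 5}" 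
    "\<And>z. Re z > - 8 / 5 \<Longrightarrow> B z = G z + (z + 2) powr (- 2 * s) * B (kap z)"
proof -
  define H where "H = {z. Re z > - 8 / 5}"
  define G' where "G' = (\<lambda>z::complex. (z + phi) powr (2 * s) * G z)"
  define q where "q = kap_factor s"
  have nz: "z + phi \<notin> \<real>\<^sub>\<le>\<^sub>0" "z + phi \<noteq> 0" if "z \<in> H" for z
  proof -
    have "Re (z + phi) > 0" using that by (intro Re_add_phi_pos) (simp add: H_def)
    then show "z + phi \<notin> \<real>\<^sub>\<le>\<^sub>0" "z + phi \<noteq> 0" using not_nonpos_Reals[of "z + phi"] by auto
  qed
  have "open H" unfolding H_def by (rule open_halfspace_Re_gt)
  have G': "G' holomorphic_on H"
    unfolding G'_def using G nz by (intro holomorphic_intros) (auto simp: H_def)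
  have kapH: "kap z \<in> H" if "z \<in> H" for z
    using kap_Re[of z] that by (auto simp: H_def)
  have iterH: "(kap ^^ k) z \<in> H" if "z \<in> H" for k z
    using that by (induction k) (auto intro: kapH)
  have kap_hol: "kap holomorphic_on H"
    unfolding kap_def[abs_def] by (intro holomorphic_intros) (auto simp: H_def complex_eq_iff)
  have iter_hol: "(kap ^^ k) holomorphic_on H" for k
  proof (induction k)
    case (Suc k)
    have "kap \<circ> (kap ^^ k) holomorphic_on H"
      by (rule holomorphic_on_compose_gen[OF Suc kap_hol]) (auto intro: iterH)
    then show ?case by (simp add: comp_def)
  qed (simp add: holomorphic_on_id)
  \<comment> \<open>This disk, with diameter from \<open>-3/2\<close> to 1, contains the image of
    \<open>H\<close> under \<open>kap\<close>.\<close>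
  have sub: "cball (- 1 / 4) (5 / 4) \<subseteq> H"
    using cball_Re_ge[of _ "-1/4" "5/4"] by (force simp: H_def)
  have kap_cball: "kap z \<in> cball (- 1 / 4) (5 / 4)" if "z \<in> H" for z
    using kap_in_cball[of "2 / 5" z] that by (simp add: H_def)
  have "continuous_on (cball (- 1 / 4) (5 / 4)) G'"
    by (intro holomorphic_on_imp_continuous_on holomorphic_on_subset[OF G' sub])
  from compact_imp_bounded[OF compact_continuous_image[OF this compact_cball]]
  obtain M where M: "\<And>z. z \<in> cball (- 1 / 4) (5 / 4) \<Longrightarrow> norm (G' z) \<le> M"
    unfolding bounded_iff by (metis imageI)
  define B' where "B' = (\<lambda>z. \<Sum>k. q ^ k * G' ((kap ^^ k) z))"
  have lim: "uniform_limit H (\<lambda>n z. \<Sum>k<n. q ^ k * G' ((kap ^^ k) z)) B' sequentially"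
    unfolding B'_def
  proof (rule Weierstrass_m_test_ev)
    \<comment> \<open>The function \<open>G'\<close> may be unbounded on \<open>H\<close>, so the
      term \<open>k = 0\<close> is left out; all later iterates lie in the compact disk.\<close>
    show "\<forall>\<^sub>F k in sequentially. \<forall>z\<in>H. norm (q ^ k * G' ((kap ^^ k) z)) \<le> norm q ^ k * M"
      using eventually_gt_at_top[of 0]
    proof eventually_elim
      case (elim k)
      then obtain j where "k = Suc j" using gr0_implies_Suc by blast
      then show ?case using M[OF kap_cball] iterH
        by (auto simp: norm_mult norm_power intro!: mult_left_mono)
    qed
    show "summable (\<lambda>k. norm q ^ k * M)"
      using norm_kap_factor[OF s] by (intro summable_mult2 summable_geometric) (simp add: q_def)
  qed
  have B'_hol: "B' holomorphic_on H"
  proof (rule holomorphic_uniform_sequence[OF \<open>open H\<close>])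
    show "(\<lambda>z. \<Sum>k<n. q ^ k * G' ((kap ^^ k) z)) holomorphic_on H" for n
      by (intro holomorphic_intros holomorphic_on_compose_gen[OF iter_hol G', unfolded o_def])
         (auto intro: iterH)
    show "\<exists>d>0. cball x d \<subseteq> H \<and> uniform_limit (cball x d) (\<lambda>n z. \<Sum>k<n. q ^ k * G' ((kap ^^ k) z)) B' sequentially"
      if "x \<in> H" for x
      using open_contains_cball[of H] \<open>open H\<close> that uniform_limit_on_subset[OF lim] by blast
  qed
  have B'_eq: "B' z = G' z + q * B' (kap z)" if "z \<in> H" for z
  proof -
    have sums: "(\<lambda>k. q ^ k * G' ((kap ^^ k) z)) sums B' z" if "z \<in> H" for z
      using tendsto_uniform_limitI[OF lim that] by (simp add: sums_def)
    have "(\<lambda>k. q ^ Suc k * G' ((kap ^^ Suc k) z)) sums (q * B' (kap z))"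
      using sums_mult[OF sums[OF kapH[OF that]], of q] by (simp add: funpow_swap1 mult.assoc)
    from sums_Suc[OF this] have "(\<lambda>k. q ^ k * G' ((kap ^^ k) z)) sums (q * B' (kap z) + G' z)" by simp
    from sums_unique2[OF sums[OF that] this] show ?thesis by simp
  qed
  define B where "B = (\<lambda>z::complex. (z + phi) powr (- 2 * s) * B' z)"
  have w: "(z + phi) powr (- 2 * s) * (z + phi) powr (2 * s) = 1" if "z \<in> H" for z
    using nz[OF that] unfolding powr_add[symmetric] by simp
  have "B z = G z + (z + 2) powr (- 2 * s) * B (kap z)" if "z \<in> H" for z
  proof -
    have "B' (kap z) = (kap z + phi) powr (2 * s) * B (kap z)"
      unfolding B_def using w[OF kapH[OF that]] by algebra
    moreover have "B z = (z + phi) powr (- 2 * s) * ((z + phi) powr (2 * s) * G z + q * B' (kap z))"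
      unfolding B_def B'_eq[OF that] G'_def ..
    moreover have "q * (kap z + phi) powr (2 * s) = (z + phi) powr (2 * s) * (z + 2) powr (- 2 * s)"
      using kap_weight[of z s] that unfolding H_def q_def by simp
    ultimately show ?thesis using w[OF that] by algebra
  qed
  moreover have "B holomorphic_on H"
    unfolding B_def using nz by (intro holomorphic_intros B'_hol) auto
  ultimately show ?thesis using that unfolding H_def by blast
qed

section \<open>Period functions of a given parity\<close>

definition mayer_eig :: "complex \<Rightarrow> complex \<Rightarrow> (complex \<Rightarrow> complex) set" where
  "mayer_eig s \<epsilon> = {f \<in> disk_algebra 1 (3/2). \<forall>z \<in> cball 1 (3/2). regsum s f (z + 1) = \<epsilon> * f z}"

text \<open>Eigenpairs of the nearest integer operator with
  \<open>f\<^sub>1 (- z) = \<epsilon> * f\<^sub>2 z\<close>, recorded by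
  \<open>h = f\<^sub>2\<close>. As \<open>\<epsilon> * \<epsilon> = 1\<close>, both component
  equations reduce to this one.\<close>

definition nearest_eig :: "complex \<Rightarrow> complex \<Rightarrow> (complex \<Rightarrow> complex) set" where
  "nearest_eig s \<epsilon> = {h \<in> disk_algebra 0 1.
     \<forall>z \<in> cball 0 1. h z = \<epsilon> * regsum s h (2 + z) + regsum s h (3 - z)}"

text \<open>With \<open>regsum s h (2 + z) = \<epsilon> * B z\<close> this is
  \<open>B z + \<epsilon> * (z + 1) powr (- 2 * s) * B (1 / (z + 1))\<close>; in the second summand
  the two signs cancel.\<close>

definition to_mayer :: "complex \<Rightarrow> complex \<Rightarrow> (complex \<Rightarrow> complex) \<Rightarrow> complex \<Rightarrow> complex" where
  "to_mayer s \<epsilon> h = (\<lambda>z. if z \<in> cball 1 (3/2) then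
     \<epsilon> * regsum s h (2 + z) + (z + 1) powr (- 2 * s) * regsum s h (2 + 1 / (z + 1)) else 0)"

lemma powr_shift_neg_tendsto_0:
  fixes x s :: complex
  assumes "Re x > 0" "Re s > 0"
  shows "(\<lambda>n. (x + of_nat n) powr (- 2 * s)) \<longlonglongrightarrow> 0"
proof -
  have "(\<lambda>N. (x + of_nat N) powr (- 2 * s) - of_nat N powr (- 2 * s)) \<longlonglongrightarrow> 0"
    using assms by (intro powr_shift_tendsto_0) auto
  moreover have "(\<lambda>N. of_nat N powr (- 2 * s)) \<longlonglongrightarrow> 0"
    using assms by (intro tendsto_neg_powr_complex_of_nat filterlim_ident) auto
  ultimately have "(\<lambda>N. (x + of_nat N) powr (- 2 * s) - of_nat N powr (- 2 * s)
      + of_nat N powr (- 2 * s)) \<longlonglongrightarrow> 0 + 0"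
    by (rule tendsto_add)
  then show ?thesis by simp
qed

lemma one_over_shift_tendsto_0: "(\<lambda>n. 1 / (x + of_nat n) :: complex) \<longlonglongrightarrow> 0"
  by (intro tendsto_divide_0[OF tendsto_const] tendsto_add_filterlim_at_infinity[OF tendsto_const] 
      tendsto_of_nat)

lemma one_over_in_cball: "Re w \<ge> 1 \<Longrightarrow> 1 / w \<in> cball 0 1"
  using complex_Re_le_cmod[of w] by (auto simp: norm_divide divide_le_eq_1)

lemma one_over_in_ball: "Re w > 1 \<Longrightarrow> 1 / w \<in> ball 0 1"
  using complex_Re_le_cmod[of w] by (auto simp: norm_divide divide_less_eq_1)

lemma powr_mult_one_over_add:
  fixes w q :: complex
  assumes "Re w > 0" "Re a \<ge> 0"
  shows "w powr q * (1 / w + a) powr q = (a * w + 1) powr q"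
proof -
  have "w \<noteq> 0" "Re (1 / w + a) > 0" using assms Re_inverse_pos[of w] by auto
  then show ?thesis
    using powr_mult_Re_pos[of w "1 / w + a" q] assms by (simp add: distrib_left mult.commute add.commute)
qed

lemma kap_eq: "z + 2 \<noteq> 0 \<Longrightarrow> kap z = 1 - 1 / (z + 2)"
  unfolding kap_def by (simp add: field_simps)

context
  fixes s \<epsilon> :: complex
  assumes s: "Re s > 0" "s \<noteq> 1/2" and eps: "\<epsilon> * \<epsilon> = 1"
begin

section \<open>From nearest integer eigenfunctions to Mayer eigenfunctions\<close>

context
  fixes h assumes h: "h \<in> nearest_eig s \<epsilon>"
begin

lemma nearest_eig_disk_algebra: "h \<in> disk_algebra 0 1"
  using h unfolding nearest_eig_def by simp

lemma nearest_eig_regsum_rec: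
  assumes "Re z \<ge> -1"
  shows "regsum s h (2 + z) - regsum s h (2 + (z + 1)) = (z + 2) powr (- 2 * s) * h (1 / (z + 2))"
proof -
  obtain K where "\<And>x. Re x \<ge> 1 \<Longrightarrow> Lipschitz_along K h x"
    using unit_disk_Lipschitz_along[OF nearest_eig_disk_algebra] by blast
  then have "Lipschitz_along K h (2 + z)" using assms by simp
  from regsum_rec[OF s this] show ?thesis by (simp add: add_ac)
qed

text \<open>Writing \<open>3 - z\<close> as \<open>2 + (1 - z)\<close> expresses \<open>h\<close>
  through the single function \<open>regsum s h (2 + z)\<close>, taken at \<open>z\<close> and at
  \<open>1 - z\<close>.\<close>

lemma nearest_eig_eq:
  "z \<in> cball 0 1 \<Longrightarrow> h z = \<epsilon> * regsum s h (2 + z) + regsum s h (2 + (1 - z))"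
  using h unfolding nearest_eig_def by simp

lemma nearest_eig_regsum_holomorphic: "(\<lambda>z. regsum s h (2 + z)) holomorphic_on {z. Re z > -1}"
proof -
  obtain K where K: "\<And>x. Re x \<ge> 1 \<Longrightarrow> Lipschitz_along K h x"
    using unit_disk_Lipschitz_along[OF nearest_eig_disk_algebra] by blast
  have "regsum s h holomorphic_on {x. Re x > 1}"
  proof (rule holomorphic_regsum[OF _ _ _ _ s(1)])
    show "open {x. Re x > 1}" by (rule open_halfspace_Re_gt)
    show "h holomorphic_on ball 0 1"
      using nearest_eig_disk_algebra unfolding disk_algebra_def by simp
    show "Lipschitz_along K h x" if "x \<in> {x. Re x > 1}" for x using that K by simp
    show "1 / (x + of_nat n) \<in> ball 0 1" if "x \<in> {x. Re x > 1}" for x n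
      using that by (intro one_over_in_ball) simp
  qed
  then show ?thesis
    by (rule holomorphic_on_compose_gen[where g = "regsum s h", unfolded o_def, rotated])
       (auto intro!: holomorphic_intros)
qed

lemma to_mayer_formula_holomorphic:
  "(\<lambda>z. \<epsilon> * regsum s h (2 + z) + (z + 1) powr (- 2 * s) * regsum s h (2 + 1 / (z + 1)))
     holomorphic_on {z. Re z > -1}"
proof -
  have nr: "z + 1 \<notin> \<real>\<^sub>\<le>\<^sub>0" "z + 1 \<noteq> 0" if "Re z > -1" for z
    using not_nonpos_Reals[of "z + 1"] that by auto
  have "(\<lambda>z. regsum s h (2 + 1 / (z + 1))) holomorphic_on {z. Re z > -1}"
  proof (rule holomorphic_on_compose_gen[OF _ nearest_eig_regsum_holomorphic, unfolded o_def])
    show "(\<lambda>z. 1 / (z + 1)) holomorphic_on {z. Re z > -1}"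
      by (intro holomorphic_intros) (use nr in auto)
    show "(\<lambda>z. 1 / (z + 1)) ` {z. Re z > -1} \<subseteq> {z. Re z > -1}"
    proof safe
      fix z :: complex assume "Re z > -1"
      then have "Re (1 / (z + 1)) > 0" by (intro Re_inverse_pos) simp
      then show "Re (1 / (z + 1)) > -1" by linarith
    qed
  qed
  then show ?thesis
    by (intro holomorphic_intros nearest_eig_regsum_holomorphic) (use nr in auto)
qed

lemma to_mayer_disk_algebra: "to_mayer s \<epsilon> h \<in> disk_algebra 1 (3/2)"
proof -
  have sub: "cball 1 (3/2) \<subseteq> {z. Re z > -1}"
    using cball_Re_ge[of _ 1 "3/2"] by force
  have "(\<lambda>z. \<epsilon> * regsum s h (2 + z) + (z + 1) powr (- 2 * s) * regsum s h (2 + 1 / (z + 1)))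
     holomorphic_on cball 1 (3/2)"
    by (rule holomorphic_on_subset[OF to_mayer_formula_holomorphic sub])
  then have "to_mayer s \<epsilon> h holomorphic_on cball 1 (3/2)"
    by (rule holomorphic_transform) (simp add: to_mayer_def)
  then show ?thesis
    unfolding disk_algebra_def
    by (auto intro: holomorphic_on_imp_continuous_on holomorphic_on_subset simp: to_mayer_def)
qed

text \<open>With \<open>w = x + n\<close>, the term \<open>w powr (- 2 * s) * f (1 / w)\<close>
  contains \<open>(w + 1) powr (- 2 * s) * R (1 - 1 / (w + 1))\<close>. The eigenfunction equation
  at \<open>1 / (w + 1)\<close> trades this for \<open>h\<close> and \<open>R\<close> at the same
  point, and the recursion turns the part with \<open>h\<close> into \<open>R (w - 1) - R w\<close>.
  What remains is a difference of consecutive values of \<open>G\<close>.\<close>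

lemma to_mayer_mem: "to_mayer s \<epsilon> h \<in> mayer_eig s \<epsilon>"
proof -
  define R where "R = (\<lambda>z. regsum s h (2 + z))"
  define f where "f = to_mayer s \<epsilon> h"
  obtain K where K: "\<And>x. Re x > 2/5 \<Longrightarrow> Lipschitz_along K f x"
    using mayer_Lipschitz_along[OF to_mayer_disk_algebra] unfolding f_def by blast
  obtain K' where K': "\<And>x. Re x \<ge> 1 \<Longrightarrow> Lipschitz_along K' h x"
    using unit_disk_Lipschitz_along[OF nearest_eig_disk_algebra] by blast
  have "regsum s f (z + 1) = \<epsilon> * f z" if z: "z \<in> cball 1 (3/2)" for z
  proof -
    define x where "x = z + 1"
    have x: "Re x \<ge> 1/2" using cball_Re_ge[OF z] by (simp add: x_def)
    define G where "G n = \<epsilon> * ((x + of_nat n) powr (- 2 * s) * R (1 / (x + of_nat n))) + R (x + of_nat n - 1)"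
      for n
    have "regsum s f x = G 0"
    proof (rule regsum_telescope[OF s K])
      show "2 / 5 < Re x" using x by simp
      show "(x + of_nat n) powr (- 2 * s) * f (1 / (x + of_nat n)) = G n - G (Suc n)" for n
      proof -
        define w where "w = x + of_nat n"
        have w: "Re w \<ge> 1/2" "w \<noteq> 0" "w + 1 \<noteq> 0" using x by (auto simp: w_def complex_eq_iff)
        have "1 / w \<in> cball 1 (3/2)" using inverse_in_mayer_ball[of w] w by auto
        then have fw: "f (1 / w) = \<epsilon> * R (1 / w) + (1 / w + 1) powr (- 2 * s) * R (1 / (1 / w + 1))"
          unfolding f_def to_mayer_def R_def by simp
        have "1 / (1 / w + 1) = 1 - 1 / (w + 1)"
          using w by (simp add: field_simps)
        moreover have "w powr (- 2 * s) * (1 / w + 1) powr (- 2 * s) = (w + 1) powr (- 2 * s)"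
          using powr_mult_one_over_add[of w 1 "- 2 * s"] w by simp
        ultimately have 1: "w powr (- 2 * s) * f (1 / w) =
           \<epsilon> * (w powr (- 2 * s) * R (1 / w)) + (w + 1) powr (- 2 * s) * R (1 - 1 / (w + 1))"
          unfolding fw by algebra
        have 2: "R (w - 1) - R w = (w + 1) powr (- 2 * s) * h (1 / (w + 1))"
          using nearest_eig_regsum_rec[of "w - 1"] w unfolding R_def by (simp add: algebra_simps)
        have 3: "h (1 / (w + 1)) = \<epsilon> * R (1 / (w + 1)) + R (1 - 1 / (w + 1))"
          using nearest_eig_eq[OF one_over_in_cball[of "w + 1"]] w unfolding R_def by simp
        have "G n - G (Suc n) = \<epsilon> * (w powr (- 2 * s) * R (1 / w)) + R (w - 1)
            - \<epsilon> * ((w + 1) powr (- 2 * s) * R (1 / (w + 1))) - R w"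
          unfolding G_def w_def by (simp add: algebra_simps)
        then show ?thesis using 1 2 unfolding w_def[symmetric] 3 by algebra
      qed
      have "isCont R 0"
        using holomorphic_on_imp_continuous_on[OF nearest_eig_regsum_holomorphic]
          open_halfspace_Re_gt[of "-1"]
        unfolding R_def by (simp add: continuous_on_eq_continuous_at)
      then have "(\<lambda>n. R (1 / (x + of_nat n))) \<longlonglongrightarrow> R 0"
        by (rule isCont_tendsto_compose[OF _ one_over_shift_tendsto_0])
      from tendsto_mult[OF powr_shift_neg_tendsto_0[of x s] this]
      have "(\<lambda>n. \<epsilon> * ((x + of_nat n) powr (- 2 * s) * R (1 / (x + of_nat n)))) \<longlonglongrightarrow> \<epsilon> * 0"
        using x s by (intro tendsto_mult_left) auto
      then have "reg_limit s (\<lambda>n. \<epsilon> * ((x + of_nat n) powr (- 2 * s) * R (1 / (x + of_nat n)))) 0"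
        by (intro reg_limit_tendsto) simp
      \<comment> \<open>The other summand of \<open>G\<close> tends to 0 in the ordinary sense; this
        one is a tail of the continued sum and vanishes only in the regularised sense.\<close>
      moreover have "reg_limit s (\<lambda>n. R (x + of_nat n - 1)) 0"
        using reg_limit_regsum_tail[OF s K'[of "x + 1"]] x unfolding R_def by (simp add: algebra_simps)
      ultimately show "reg_limit s G 0"
        unfolding G_def using reg_limit_add by fastforce
    qed
    \<comment> \<open>At \<open>n = 0\<close>, where \<open>x = z + 1\<close>, the value
      \<open>G 0\<close> is the defining formula of \<open>f z\<close> multiplied by
      \<open>\<epsilon>\<close>, because \<open>\<epsilon> * \<epsilon> = 1\<close>.\<close>
    also have "G 0 = \<epsilon> * f z"
      using z eps unfolding G_def f_def to_mayer_def R_def x_def by (simp add: algebra_simps)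
    finally show ?thesis unfolding x_def .
  qed
  then show ?thesis using to_mayer_disk_algebra unfolding mayer_eig_def f_def by simp
qed

text \<open>In \<open>R z - R (z + 1) = (z + 2) powr (- 2 * s) * h (1 / (z + 2))\<close>, vanishing
  of the image at \<open>z + 1\<close> cancels \<open>R (z + 1)\<close> against the part of
  \<open>h\<close> with \<open>R (1 / (z + 2))\<close>. This leaves the homogeneous equation for
  \<open>kap\<close>, so \<open>R\<close> vanishes, and \<open>h\<close> with it.\<close>

lemma to_mayer_eq_0_imp:
  assumes zero: "\<And>z. z \<in> cball 1 (3/2) \<Longrightarrow> to_mayer s \<epsilon> h z = 0"
  shows "h = (\<lambda>_. 0)"
proof -
  define R where "R = (\<lambda>z. regsum s h (2 + z))"
  \<comment> \<open>The identity is needed at \<open>z + 1\<close> for all \<open>Re z > -1\<close>,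
    far beyond Mayer's disk, hence the analytic continuation.\<close>
  have f0: "\<epsilon> * R z + (z + 1) powr (- 2 * s) * R (1 / (z + 1)) = 0" if "Re z > -1" for z
    unfolding R_def
  proof (rule analytic_continuation_open[of "ball 1 (3/2)" "{z. Re z > -1}"
      "\<lambda>z. \<epsilon> * regsum s h (2 + z) + (z + 1) powr (- 2 * s) * regsum s h (2 + 1 / (z + 1))" "\<lambda>_. 0"])
    show "ball 1 (3/2) \<subseteq> {z. Re z > -1}"
      by (rule subsetI, drule subsetD[OF ball_subset_cball], drule cball_Re_ge) simp
    show "connected {z. Re z > -1}" by (intro convex_connected convex_halfspace_Re_gt)
    show "\<epsilon> * regsum s h (2 + z) + (z + 1) powr (- 2 * s) * regsum s h (2 + 1 / (z + 1)) = 0"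
      if "z \<in> ball 1 (3/2)" for z
      using zero[of z] that unfolding to_mayer_def by auto
  qed (use that in \<open>auto intro: open_halfspace_Re_gt to_mayer_formula_holomorphic[simplified]\<close>)
  have R0: "R z = 0" if "Re z > -1" for z
  proof (rule kap_invariant_imp_0[OF s(1), of "{z. Re z > -1}" R])
    show sub: "cball (1/2) (1/2) \<subseteq> {z. Re z > -1}"
      using cball_Re_ge[of _ "1/2" "1/2"] by force
    show "continuous_on (cball (1/2) (1/2)) R"
      unfolding R_def by (intro holomorphic_on_imp_continuous_on
          holomorphic_on_subset[OF nearest_eig_regsum_holomorphic sub])
    show "R z = (z + 2) powr (- 2 * s) * R (kap z)" if "z \<in> {z. Re z > -1}" for z
    proof -
      have z: "Re (z + 2) \<ge> 1" "z + 2 \<noteq> 0" "Re z \<ge> -1" using that by (auto simp: complex_eq_iff)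
      have "R z - R (z + 1) = (z + 2) powr (- 2 * s) * h (1 / (z + 2))"
        using nearest_eig_regsum_rec[OF z(3)] unfolding R_def .
      moreover have "h (1 / (z + 2)) = \<epsilon> * R (1 / (z + 2)) + R (kap z)"
        using nearest_eig_eq[OF one_over_in_cball[OF z(1)]] z(2) unfolding R_def by (simp add: kap_eq)
      moreover have "\<epsilon> * R (z + 1) + (z + 2) powr (- 2 * s) * R (1 / (z + 2)) = 0"
        using f0[of "z + 1"] that by (simp add: add.assoc)
      ultimately show ?thesis using eps by algebra
    qed
  qed (use that in auto)
  have h0: "h z = 0" if "z \<in> cball 0 1" "Re z > -1" for z
    using nearest_eig_eq[OF that(1)] R0[of z] R0[of "1 - z"] that cball_Re_le[OF that(1)]
    unfolding R_def by simp
  have "h z = 0" if z: "z \<in> cball 0 1" for z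
  proof -
    have Re: "Re z \<ge> -1" "Re z \<le> 1" using cball_Re_ge[OF z] cball_Re_le[OF z] by auto
    \<comment> \<open>In the closed unit disk only \<open>z = -1\<close> is still open, a point
      outside the domain on which \<open>R = 0\<close> is known. There the recursion expresses
      \<open>R (-1)\<close> by \<open>R 0\<close> and \<open>h 1\<close>.\<close>
    have "Re (1 / (z + 2)) > 0" using Re by (intro Re_inverse_pos) simp
    then have "h (1 / (z + 2)) = 0" using Re by (intro h0 one_over_in_cball) auto
    then have "R z = 0"
      using nearest_eig_regsum_rec[OF Re(1)] R0[of "z + 1"] Re unfolding R_def by simp
    then show ?thesis using nearest_eig_eq[OF z] R0[of "1 - z"] Re unfolding R_def by simp
  qed
  moreover have "h z = 0" if "z \<notin> cball 0 1" for z
    using that nearest_eig_disk_algebra unfolding disk_algebra_def by simp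
  ultimately show ?thesis by blast
qed

end

text \<open>A Neumann series yields a candidate \<open>B\<close>. Homogeneous uniqueness shows that
  \<open>B\<close> reproduces \<open>f\<close>; telescoping shows that the \<open>h\<close> built
  from \<open>B\<close> has \<open>\<epsilon> * B\<close> as its Mayer sum.\<close>

lemma to_mayer_surj:
  assumes f: "f \<in> mayer_eig s \<epsilon>"
  obtains h where "h \<in> nearest_eig s \<epsilon>" "to_mayer s \<epsilon> h = f"
proof -
  have fda: "f \<in> disk_algebra 1 (3/2)" using f unfolding mayer_eig_def by simp
  obtain K where K: "\<And>x. Re x > 2/5 \<Longrightarrow> Lipschitz_along K f x"
    using mayer_Lipschitz_along[OF fda] by blast
  \<comment> \<open>The eigenfunction equation itself extends \<open>f\<close> to
    \<open>Re z > - 3 / 5\<close>, where \<open>Re (z + 1) > 2 / 5\<close>.\<close>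
  define f0 where "f0 = (\<lambda>z. \<epsilon> * regsum s f (z + 1))"
  have f0: "f0 z = f z" if "z \<in> cball 1 (3/2)" for z
    using f that eps unfolding mayer_eig_def f0_def by (simp add: mult.assoc[symmetric])
  have f0_hol: "f0 holomorphic_on {z. Re z > - 3 / 5}"
  proof -
    have "regsum s f holomorphic_on {x. Re x > 2 / 5}"
    proof (rule holomorphic_regsum[OF _ _ _ _ s(1)])
      show "open {x. Re x > 2 / 5}" by (rule open_halfspace_Re_gt)
      show "f holomorphic_on ball 1 (3/2)" using fda unfolding disk_algebra_def by simp
      show "Lipschitz_along K f x" if "x \<in> {x. Re x > 2 / 5}" for x using that K by simp
      show "1 / (x + of_nat n) \<in> ball 1 (3/2)" if "x \<in> {x. Re x > 2 / 5}" for x n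
        using that by (intro inverse_in_mayer_ball) simp
    qed
    then have "(\<lambda>z. regsum s f (z + 1)) holomorphic_on {z. Re z > - 3 / 5}"
      by (rule holomorphic_on_compose_gen[where g = "regsum s f", unfolded o_def, rotated])
         (auto intro!: holomorphic_intros)
    then show ?thesis unfolding f0_def by (intro holomorphic_intros)
  qed
  \<comment> \<open>The three-term equation of Lewis, obtained by splitting off the first term of
    the Mayer sum.\<close>
  have Lewis: "f0 (w - 1) - f0 w = \<epsilon> * (w powr (- 2 * s) * f0 (1 / w))" if "Re w > 2 / 5" for w
    using regsum_rec[OF s K[OF that]] f0[of "1 / w"] inverse_in_mayer_ball[OF that]
    unfolding f0_def by (simp add: algebra_simps)
  have "(\<lambda>z. f0 (z + 1)) holomorphic_on {z. Re z > - 8 / 5}"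
    by (rule holomorphic_on_compose_gen[OF _ f0_hol, unfolded o_def]) (auto intro!: holomorphic_intros)
  then obtain B where B_hol: "B holomorphic_on {z. Re z > - 8 / 5}"
    and B: "\<And>z. Re z > - 8 / 5 \<Longrightarrow> B z = f0 (z + 1) + (z + 2) powr (- 2 * s) * B (kap z)"
    using kap_Neumann[OF s(1)] by metis
  \<comment> \<open>The defect between \<open>f0\<close> and the function that \<open>B\<close>
    should reproduce. It satisfies the homogeneous equation for \<open>kap\<close>.\<close>
  define E where "E = (\<lambda>z. B z + \<epsilon> * ((z + 1) powr (- 2 * s) * B (1 / (z + 1))) - f0 z)"
  have E0: "E z = 0" if "Re z > - 3 / 5" for z
  proof (rule kap_invariant_imp_0[OF s(1), of "{z. Re z > - 3 / 5}" E])
    show sub: "cball (1/2) (1/2) \<subseteq> {z. Re z > - 3 / 5}"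
      using cball_Re_ge[of _ "1/2" "1/2"] by force
    have "E holomorphic_on {z. Re z > - 3 / 5}"
    proof -
      have nr: "z + 1 \<notin> \<real>\<^sub>\<le>\<^sub>0" "z + 1 \<noteq> 0" if "Re z > - 3 / 5" for z
        using not_nonpos_Reals[of "z + 1"] that by auto
      have "(\<lambda>z. B (1 / (z + 1))) holomorphic_on {z. Re z > - 3 / 5}"
      proof (rule holomorphic_on_compose_gen[OF _ B_hol, unfolded o_def])
        show "(\<lambda>z. 1 / (z + 1)) holomorphic_on {z. Re z > - 3 / 5}"
          by (intro holomorphic_intros) (use nr in auto)
        show "(\<lambda>z. 1 / (z + 1)) ` {z. Re z > - 3 / 5} \<subseteq> {z. Re z > - 8 / 5}"
        proof safe
          fix z :: complex assume "Re z > - 3 / 5"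
          then have "Re (1 / (z + 1)) > 0" by (intro Re_inverse_pos) simp
          then show "Re (1 / (z + 1)) > - 8 / 5" by linarith
        qed
      qed
      moreover have "B holomorphic_on {z. Re z > - 3 / 5}"
        by (rule holomorphic_on_subset[OF B_hol]) auto
      ultimately show ?thesis
        unfolding E_def by (intro holomorphic_intros f0_hol) (use nr in auto)
    qed
    then show "continuous_on (cball (1/2) (1/2)) E"
      by (intro holomorphic_on_imp_continuous_on holomorphic_on_subset[OF _ sub])
    show "E z = (z + 2) powr (- 2 * s) * E (kap z)" if "z \<in> {z. Re z > - 3 / 5}" for z
    proof -
      define w where "w = z + 1"
      have zw: "z = w - 1" "z + 1 = w" "z + 2 = w + 1" by (auto simp: w_def)
      have w: "Re w > 2 / 5" "Re w > 0" "Re (1 / w) > 0" using that Re_inverse_pos[of w] by (auto simp: w_def)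
      have nz: "w \<noteq> 0" "w + 1 \<noteq> 0" "2 * w + 1 \<noteq> 0" using w(2) by (auto simp: complex_eq_iff)
      have kw: "kap (w - 1) = 1 / (1 / w + 1)" "kap (w - 1) + 1 = (2 * w + 1) / (w + 1)"
        using nz unfolding kap_def by (auto simp: field_simps)
      \<comment> \<open>The map \<open>kap\<close> commutes with the map sending \<open>z\<close> to
        \<open>1 / (z + 1)\<close>, being its square.\<close>
      have k1: "1 / (kap (w - 1) + 1) = kap (1 / w)"
      proof -
        have "1 / w + 1 = (w + 1) / w" "1 / w + 2 = (2 * w + 1) / w"
          using nz by (auto simp: field_simps)
        then show ?thesis unfolding kw(2) unfolding kap_def using nz by simp
      qed
      have p1: "w powr (- 2 * s) * (1 / w + 1) powr (- 2 * s) = (w + 1) powr (- 2 * s)"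
        using powr_mult_one_over_add[of w 1 "- 2 * s"] w by simp
      have p2: "w powr (- 2 * s) * (1 / w + 2) powr (- 2 * s) = (2 * w + 1) powr (- 2 * s)"
        using powr_mult_one_over_add[of w 2 "- 2 * s"] w by simp
      have p3: "(w + 1) powr (- 2 * s) * (kap (w - 1) + 1) powr (- 2 * s) = (2 * w + 1) powr (- 2 * s)"
      proof -
        have "Re (kap (w - 1)) \<ge> 0"
          using cball_Re_ge[OF kap_in_cball_half[of "w - 1"]] w by simp
        then have "((w + 1) * (kap (w - 1) + 1)) powr (- 2 * s) =
            (w + 1) powr (- 2 * s) * (kap (w - 1) + 1) powr (- 2 * s)"
          using w by (intro powr_mult_Re_pos) auto
        moreover have "(w + 1) * (kap (w - 1) + 1) = 2 * w + 1" unfolding kw(2) using nz by simp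
        ultimately show ?thesis by simp
      qed
      have B1: "B (w - 1) = f0 w + (w + 1) powr (- 2 * s) * B (kap (w - 1))"
        using B[of "w - 1"] w by (simp add: algebra_simps)
      have B2: "B (1 / w) = f0 (1 / w + 1) + (1 / w + 2) powr (- 2 * s) * B (kap (1 / w))"
        using B[of "1 / w"] w by simp
      have L1: "f0 (w - 1) - f0 w = \<epsilon> * (w powr (- 2 * s) * f0 (1 / w))" by (rule Lewis) (rule w)
      have L2: "f0 (1 / w) - f0 (1 / w + 1) = \<epsilon> * ((1 / w + 1) powr (- 2 * s) * f0 (kap (w - 1)))"
        using Lewis[of "1 / w + 1"] w unfolding kw(1) by simp
      \<comment> \<open>Two uses of the three-term equation, at \<open>w\<close> and at
        \<open>1 / w + 1\<close>. The terms \<open>f0 w\<close> and \<open>f0 (1 / w + 1)\<close>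
        are exactly the inhomogeneities in the equations for \<open>B (w - 1)\<close> and
        \<open>B (1 / w)\<close>, so they drop out of \<open>E\<close>.\<close>
      have L: "f0 (w - 1) = f0 w + \<epsilon> * (w powr (- 2 * s) * f0 (1 / w + 1)) + (w + 1) powr (- 2 * s) * f0 (kap (w - 1))"
        using L1 L2 p1 eps by algebra
      have B3: "w powr (- 2 * s) * B (1 / w) =
          w powr (- 2 * s) * f0 (1 / w + 1) + (2 * w + 1) powr (- 2 * s) * B (kap (1 / w))"
        using B2 p2 by algebra
      have "w - 1 + 1 = w" "w - 1 + 2 = w + 1" by simp_all
      then have "E z = B (w - 1) + \<epsilon> * (w powr (- 2 * s) * B (1 / w)) - f0 (w - 1)"
        and "(z + 2) powr (- 2 * s) * E (kap z) = (w + 1) powr (- 2 * s) * (B (kap (w - 1)) +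
          \<epsilon> * ((kap (w - 1) + 1) powr (- 2 * s) * B (kap (1 / w))) - f0 (kap (w - 1)))"
        unfolding E_def zw k1 by (simp_all add: add.commute)
      then show ?thesis using B1 B3 L p3 by algebra
    qed
  qed (use that in auto)
  have B': "B (w - 1) + \<epsilon> * (w powr (- 2 * s) * B (1 / w)) = f0 (w - 1)" if "Re w > 2 / 5" for w
    using E0[of "w - 1"] that unfolding E_def by simp
  define h where "h = (\<lambda>z. if z \<in> cball 0 1 then B z + \<epsilon> * B (1 - z) else 0)"
  have hda: "h \<in> disk_algebra 0 1"
  proof -
    have sub: "cball 0 1 \<subseteq> {z. Re z > - 8 / 5}" 
      using cball_Re_ge[of _ 0 1] by force
    have "(\<lambda>z. B (1 - z)) holomorphic_on cball 0 1"
      by (rule holomorphic_on_compose_gen[OF _ B_hol, unfolded o_def])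
         (use cball_Re_le[of _ 0 1] in \<open>force intro!: holomorphic_intros\<close>)+
    then have "(\<lambda>z. B z + \<epsilon> * B (1 - z)) holomorphic_on cball 0 1"
      by (intro holomorphic_intros holomorphic_on_subset[OF B_hol sub])
    then have "h holomorphic_on cball 0 1"
      by (rule holomorphic_transform) (simp add: h_def)
    then show ?thesis
      unfolding disk_algebra_def
      by (auto intro: holomorphic_on_imp_continuous_on holomorphic_on_subset simp: h_def)
  qed
  obtain K' where K': "\<And>x. Re x \<ge> 1 \<Longrightarrow> Lipschitz_along K' h x"
    using unit_disk_Lipschitz_along[OF hda] by blast
  \<comment> \<open>As \<open>1 - 1 / w = kap (w - 2)\<close>, the two values of \<open>B\<close> in
    \<open>h (1 / w)\<close> are those in the Neumann equation at \<open>w - 2\<close> and in the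
    reproducing formula at \<open>w\<close>. Subtracting these removes \<open>f0 (w - 1)\<close> and
    leaves \<open>B (w - 2) - B (w - 1)\<close>.\<close>
  have R: "regsum s h (2 + z) = \<epsilon> * B z" if z: "Re z \<ge> -1" for z
  proof -
    have "regsum s h (2 + z) = \<epsilon> * B (z + of_nat 0)"
    proof (rule regsum_telescope[OF s K'])
      show "Re (2 + z) \<ge> 1" using z by simp
      show "(2 + z + of_nat n) powr (- 2 * s) * h (1 / (2 + z + of_nat n)) =
          \<epsilon> * B (z + of_nat n) - \<epsilon> * B (z + of_nat (Suc n))" for n
      proof -
        define w where "w = 2 + z + of_nat n"
        have w: "Re w \<ge> 1" "w \<noteq> 0" using z by (auto simp: w_def complex_eq_iff)
        have zw: "z + of_nat n = w - 2" "z + of_nat (Suc n) = w - 1" by (auto simp: w_def)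
        have "h (1 / w) = B (1 / w) + \<epsilon> * B (kap (w - 2))"
          using one_over_in_cball[OF w(1)] w(2) kap_eq[of "w - 2"] unfolding h_def by simp
        moreover have "B (w - 2) = f0 (w - 1) + w powr (- 2 * s) * B (kap (w - 2))"
          using B[of "w - 2"] w by simp
        moreover have "B (w - 1) + \<epsilon> * (w powr (- 2 * s) * B (1 / w)) = f0 (w - 1)"
          using B'[of w] w by simp
        ultimately show ?thesis unfolding w_def[symmetric] zw using eps by algebra
      qed
      have "isCont B 1"
        using holomorphic_on_imp_continuous_on[OF B_hol] open_halfspace_Re_gt[of "- 8 / 5"]
        by (simp add: continuous_on_eq_continuous_at)
      moreover have "(\<lambda>n. 1 - 1 / (2 + z + of_nat n)) \<longlonglongrightarrow> 1 - 0"
        by (intro tendsto_diff tendsto_const one_over_shift_tendsto_0)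
      ultimately have "(\<lambda>n. B (1 - 1 / (2 + z + of_nat n))) \<longlonglongrightarrow> B 1"
        using isCont_tendsto_compose[of 1 B] by simp
      from tendsto_mult[OF powr_shift_neg_tendsto_0[of "2 + z" s] this]
      have "(\<lambda>n. \<epsilon> * ((2 + z + of_nat n) powr (- 2 * s) * B (1 - 1 / (2 + z + of_nat n)))) \<longlonglongrightarrow> \<epsilon> * 0"
        using z s by (intro tendsto_mult_left) auto
      then have 1: "reg_limit s (\<lambda>n. \<epsilon> * ((2 + z + of_nat n) powr (- 2 * s) * B (1 - 1 / (2 + z + of_nat n)))) 0"
        by (intro reg_limit_tendsto) simp
      have 2: "reg_limit s (\<lambda>n. regsum s f (2 + z + of_nat n)) 0"
        using z by (intro reg_limit_regsum_tail[OF s K]) simp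
      \<comment> \<open>The Neumann equation compares \<open>B\<close> far to the right with a tail
        of the Mayer sum of \<open>f\<close>. The error tends to 0, since \<open>kap (z + n)\<close>
        tends to 1 and the weight to 0.\<close>
      have "\<epsilon> * B (z + of_nat n) = regsum s f (2 + z + of_nat n) +
          \<epsilon> * ((2 + z + of_nat n) powr (- 2 * s) * B (1 - 1 / (2 + z + of_nat n)))" for n
      proof -
        have "z + of_nat n + 2 \<noteq> 0" using z by (auto simp: complex_eq_iff)
        then have "B (z + of_nat n) = \<epsilon> * regsum s f (2 + z + of_nat n) +
            (2 + z + of_nat n) powr (- 2 * s) * B (1 - 1 / (2 + z + of_nat n))"
          using B[of "z + of_nat n"] z kap_eq[of "z + of_nat n"] unfolding f0_def by (simp add: add_ac)
        then show ?thesis using eps by algebra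
      qed
      then show "reg_limit s (\<lambda>n. \<epsilon> * B (z + of_nat n)) 0"
        using reg_limit_add[OF 2 1] by simp
    qed
    then show ?thesis by simp
  qed
  have "h \<in> nearest_eig s \<epsilon>"
    unfolding nearest_eig_def
  proof (intro CollectI conjI ballI hda)
    fix z :: complex assume z: "z \<in> cball 0 1"
    have "regsum s h (2 + z) = \<epsilon> * B z" "regsum s h (2 + (1 - z)) = \<epsilon> * B (1 - z)"
      using cball_Re_ge[OF z] cball_Re_le[OF z] R[of z] R[of "1 - z"] by simp_all
    moreover have "2 + (1 - z) = 3 - z" by simp
    moreover have "h z = B z + \<epsilon> * B (1 - z)" using z by (simp add: h_def)
    ultimately show "h z = \<epsilon> * regsum s h (2 + z) + regsum s h (3 - z)" using eps by algebra
  qed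
  moreover have "to_mayer s \<epsilon> h = f"
  proof
    fix z
    show "to_mayer s \<epsilon> h z = f z"
    proof (cases "z \<in> cball 1 (3/2)")
      case True
      have z: "Re z \<ge> - 1/2" using cball_Re_ge[OF True] by simp
      then have "Re (1 / (z + 1)) > 0" by (intro Re_inverse_pos) simp
      then have "regsum s h (2 + z) = \<epsilon> * B z" "regsum s h (2 + 1 / (z + 1)) = \<epsilon> * B (1 / (z + 1))"
        using z by (auto intro!: R simp del: Re_divide)
      moreover have "B z + \<epsilon> * ((z + 1) powr (- 2 * s) * B (1 / (z + 1))) = f z"
        using B'[of "z + 1"] f0[OF True] z by simp
      ultimately have "\<epsilon> * regsum s h (2 + z) + (z + 1) powr (- 2 * s) * regsum s h (2 + 1 / (z + 1)) = f z" 
        using eps by algebra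
      then show ?thesis using True unfolding to_mayer_def by simp
    next
      case False
      then show ?thesis using fda unfolding to_mayer_def disk_algebra_def by simp
    qed
  qed
  ultimately show ?thesis using that by blast
qed

end

section \<open>The correspondence\<close>

lemma disk_algebra_linear:
  assumes "f \<in> disk_algebra a r" "g \<in> disk_algebra a r"
  shows "(\<lambda>z. c * f z + d * g z) \<in> disk_algebra a r"
  using assms unfolding disk_algebra_def
  by (auto intro!: continuous_intros holomorphic_intros)

lemma regsum_linear_unit_disk:
  assumes "Re s > 0" "f \<in> disk_algebra 0 1" "g \<in> disk_algebra 0 1" "Re x \<ge> 1"
  shows "regsum s (\<lambda>z. c * f z + d * g z) x = c * regsum s f x + d * regsum s g x"
proof -
  obtain K where "\<And>x. Re x \<ge> 1 \<Longrightarrow> Lipschitz_along K f x"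
    using unit_disk_Lipschitz_along[OF assms(2)] by blast
  moreover obtain K' where "\<And>x. Re x \<ge> 1 \<Longrightarrow> Lipschitz_along K' g x"
    using unit_disk_Lipschitz_along[OF assms(3)] by blast
  ultimately show ?thesis using regsum_linear[OF assms(1)] assms(4) by blast
qed

lemma to_mayer_linear:
  assumes "Re s > 0" "f \<in> disk_algebra 0 1" "g \<in> disk_algebra 0 1"
  shows "to_mayer s \<epsilon> (\<lambda>z. c * f z + d * g z) = (\<lambda>z. c * to_mayer s \<epsilon> f z + d * to_mayer s \<epsilon> g z)"
proof
  fix z
  show "to_mayer s \<epsilon> (\<lambda>z. c * f z + d * g z) z = c * to_mayer s \<epsilon> f z + d * to_mayer s \<epsilon> g z"
  proof (cases "z \<in> cball 1 (3/2)")
    case True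
    have "Re z \<ge> -1/2" using cball_Re_ge[OF True] by simp
    moreover from this have "Re (1 / (z + 1)) > 0" by (intro Re_inverse_pos) simp
    ultimately have "1 \<le> Re (2 + z)" "1 \<le> Re (2 + 1 / (z + 1))" by simp_all
    from this[THEN regsum_linear_unit_disk[OF assms]] show ?thesis
      using True by (simp add: to_mayer_def algebra_simps)
  qed (simp add: to_mayer_def)
qed

lemma nearest_eig_linear:
  assumes s: "Re s > 0" and fg: "f \<in> nearest_eig s \<epsilon>" "g \<in> nearest_eig s \<epsilon>"
  shows "(\<lambda>z. c * f z + d * g z) \<in> nearest_eig s \<epsilon>"
proof -
  have da: "f \<in> disk_algebra 0 1" "g \<in> disk_algebra 0 1"
    using fg unfolding nearest_eig_def by auto
  have "c * f z + d * g z = \<epsilon> * regsum s (\<lambda>z. c * f z + d * g z) (2 + z) +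
      regsum s (\<lambda>z. c * f z + d * g z) (3 - z)" if z: "z \<in> cball 0 1" for z
  proof -
    have "1 \<le> Re (2 + z)" "1 \<le> Re (3 - z)" using cball_Re_ge[OF z] cball_Re_le[OF z] by auto
    from this[THEN regsum_linear_unit_disk[OF s da]] show ?thesis
      using fg z unfolding nearest_eig_def by (simp add: algebra_simps)
  qed
  then show ?thesis using disk_algebra_linear[OF da] unfolding nearest_eig_def by blast
qed

lemma bij_betw_to_mayer:
  assumes s: "Re s > 0" "s \<noteq> 1/2" and eps: "\<epsilon> * \<epsilon> = 1"
  shows "bij_betw (to_mayer s \<epsilon>) (nearest_eig s \<epsilon>) (mayer_eig s \<epsilon>)"
  unfolding bij_betw_def
proof
  show "inj_on (to_mayer s \<epsilon>) (nearest_eig s \<epsilon>)"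
  proof (rule inj_onI)
    fix g h assume gh: "g \<in> nearest_eig s \<epsilon>" "h \<in> nearest_eig s \<epsilon>"
      and eq: "to_mayer s \<epsilon> g = to_mayer s \<epsilon> h"
    have "to_mayer s \<epsilon> (\<lambda>z. 1 * g z + (-1) * h z) z = 0" for z
      using gh eq to_mayer_linear[OF s(1), of g h \<epsilon> 1 "-1"] unfolding nearest_eig_def by simp
    from to_mayer_eq_0_imp[OF s eps nearest_eig_linear[OF s(1) gh] this]
    show "g = h" by (simp add: fun_eq_iff)
  qed
  show "to_mayer s \<epsilon> ` nearest_eig s \<epsilon> = mayer_eig s \<epsilon>"
    using to_mayer_mem[OF s eps] to_mayer_surj[OF s eps] by blast
qed

text \<open>Both \<open>f\<close> and its image are 0 off the disk, so equality of functions on the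
  plane tests the eigenfunction equation on the disk only.\<close>

lemma ker_mayer_op:
  assumes s: "Re s > 0" "s \<noteq> 1/2"
  shows "ker_on mayer_space (\<lambda>f. mayer_op s f - f) = mayer_eig s 1"
    and "ker_on mayer_space (\<lambda>f. mayer_op s f + f) = mayer_eig s (- 1)"
proof -
  have "mayer_op s f - f = 0 \<longleftrightarrow> (\<forall>z \<in> cball 1 (3/2). regsum s f (z + 1) = f z)"
    and "mayer_op s f + f = 0 \<longleftrightarrow> (\<forall>z \<in> cball 1 (3/2). regsum s f (z + 1) = - f z)"
    if f: "f \<in> mayer_space" for f
  proof -
    have out: "mayer_op s f z = 0" "f z = 0" if "z \<notin> cball 1 (3/2)" for z
      using f that unfolding mayer_op_def mayer_space_def disk_algebra_def by simp_all
    have "mayer_op s f - f = 0 \<longleftrightarrow> (\<forall>z. mayer_op s f z = f z)"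
      by (simp add: fun_eq_iff)
    also have "\<dots> \<longleftrightarrow> (\<forall>z \<in> cball 1 (3/2). mayer_op s f z = f z)"
      using out by metis
    finally show "mayer_op s f - f = 0 \<longleftrightarrow> (\<forall>z \<in> cball 1 (3/2). regsum s f (z + 1) = f z)"
      using mayer_op_eq[OF s f] by simp
    have "mayer_op s f + f = 0 \<longleftrightarrow> (\<forall>z. mayer_op s f z = - f z)"
      by (simp add: fun_eq_iff eq_neg_iff_add_eq_0)
    also have "\<dots> \<longleftrightarrow> (\<forall>z \<in> cball 1 (3/2). mayer_op s f z = - f z)"
      using out by (metis neg_equal_zero neg_0_equal_iff_equal)
    finally show "mayer_op s f + f = 0 \<longleftrightarrow> (\<forall>z \<in> cball 1 (3/2). regsum s f (z + 1) = - f z)"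
      using mayer_op_eq[OF s f] by simp
  qed
  then show "ker_on mayer_space (\<lambda>f. mayer_op s f - f) = mayer_eig s 1"
    and "ker_on mayer_space (\<lambda>f. mayer_op s f + f) = mayer_eig s (- 1)"
    unfolding ker_on_def mayer_eig_def mayer_space_def by auto
qed

section \<open>Splitting by parity and assembly\<close>

definition parity :: "(complex \<Rightarrow> complex) \<times> (complex \<Rightarrow> complex) \<Rightarrow> (complex \<Rightarrow> complex) \<times> (complex \<Rightarrow> complex)" where
  "parity p = ((\<lambda>z. 1/2 * snd p z + 1/2 * fst p (- z)), (\<lambda>z. 1/2 * snd p z + (- 1/2) * fst p (- z)))"

text \<open>The operator commutes with the swap of the components combined with reflection. The sum
  and difference of the second component and the reflected first one diagonalise this
  involution.\<close>

lemma bij_betw_parity: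
  assumes s: "Re s > 0" "s \<noteq> 1/2"
  shows "bij_betw parity (ker_on nearest_space (\<lambda>p. nearest_op s p - p)) (nearest_eig s 1 \<times> nearest_eig s (- 1))"
proof -
  have ker: "(f, g) \<in> ker_on nearest_space (\<lambda>p. nearest_op s p - p) \<longleftrightarrow>
      f \<in> disk_algebra 0 1 \<and> g \<in> disk_algebra 0 1 \<and>
      (\<forall>z \<in> cball 0 1. f (- z) = regsum s (\<lambda>u. f (- u)) (3 - z) + regsum s g (2 + z) \<and>
         g z = regsum s (\<lambda>u. f (- u)) (2 + z) + regsum s g (3 - z))" for f g
  proof (cases "f \<in> disk_algebra 0 1 \<and> g \<in> disk_algebra 0 1")
    case True
    then have fg: "f \<in> disk_algebra 0 1" "g \<in> disk_algebra 0 1" by auto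
    have out: "fst (nearest_op s (f, g)) z = 0" "snd (nearest_op s (f, g)) z = 0" "f z = 0" "g z = 0"
      if "z \<notin> cball 0 1" for z
      using fg that unfolding nearest_op_def disk_algebra_def by simp_all
    have "nearest_op s (f, g) - (f, g) = 0 \<longleftrightarrow>
        (\<forall>z. fst (nearest_op s (f, g)) z = f z) \<and> (\<forall>z. snd (nearest_op s (f, g)) z = g z)"
      by (auto simp: prod_eq_iff fun_eq_iff)
    also have "\<dots> \<longleftrightarrow> (\<forall>z \<in> cball 0 1. fst (nearest_op s (f, g)) z = f z) \<and>
        (\<forall>z \<in> cball 0 1. snd (nearest_op s (f, g)) z = g z)"
      using out by metis
    \<comment> \<open>The first equation is taken at \<open>- z\<close>, so that both equations
      speak of the reflected first component.\<close>
    also have "(\<forall>z \<in> cball 0 1. fst (nearest_op s (f, g)) z = f z) \<longleftrightarrow>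
       (\<forall>z \<in> cball 0 1. fst (nearest_op s (f, g)) (- z) = f (- z))"
      by (metis minus_minus mem_cball_0 norm_minus_cancel)
    finally show ?thesis
      using fg nearest_op_eq[OF s fg] unfolding ker_on_def nearest_space_def by auto
  next
    case False
    then show ?thesis unfolding ker_on_def nearest_space_def by auto
  qed
  have lin: "regsum s (\<lambda>z. 1/2 * g z + c * f (- z)) x = 1/2 * regsum s g x + c * regsum s (\<lambda>u. f (- u)) x"
    if "f \<in> disk_algebra 0 1" "g \<in> disk_algebra 0 1" "Re x \<ge> 1" for f g c x
    using regsum_linear_unit_disk[OF s(1) that(2) disk_algebra_uminus[OF that(1)] that(3)] .
  show ?thesis
  \<comment> \<open>The factors \<open>1\<close> and \<open>- 1\<close> are kept so that the
    linearity rules match syntactically.\<close>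
  proof (rule bij_betw_byWitness[where f' = "\<lambda>(h, k). ((\<lambda>z. 1 * h (- z) + (- 1) * k (- z)), (\<lambda>z. 1 * h z + 1 * k z))"])
    show "parity ` ker_on nearest_space (\<lambda>p. nearest_op s p - p) \<subseteq> nearest_eig s 1 \<times> nearest_eig s (- 1)"
    proof (rule image_subsetI, clarify)
      fix f g assume "(f, g) \<in> ker_on nearest_space (\<lambda>p. nearest_op s p - p)"
      then have fg: "f \<in> disk_algebra 0 1" "g \<in> disk_algebra 0 1"
        and eq: "\<And>z. z \<in> cball 0 1 \<Longrightarrow> f (- z) = regsum s (\<lambda>u. f (- u)) (3 - z) + regsum s g (2 + z)"
          "\<And>z. z \<in> cball 0 1 \<Longrightarrow> g z = regsum s (\<lambda>u. f (- u)) (2 + z) + regsum s g (3 - z)"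
        unfolding ker by auto
      have "(\<lambda>z. 1/2 * g z + c * f (- z)) \<in> nearest_eig s \<epsilon>" if "(\<epsilon> = 1 \<and> c = 1/2) \<or> (\<epsilon> = -1 \<and> c = -1/2)" for \<epsilon> c
        unfolding nearest_eig_def
      proof (intro CollectI conjI ballI)
        show "(\<lambda>z. 1/2 * g z + c * f (- z)) \<in> disk_algebra 0 1"
          using disk_algebra_linear[OF fg(2) disk_algebra_uminus[OF fg(1)]] .
        fix z :: complex assume z: "z \<in> cball 0 1"
        have "1 \<le> Re (2 + z)" "1 \<le> Re (3 - z)" using cball_Re_ge[OF z] cball_Re_le[OF z] by auto
        note lins = this[THEN lin[OF fg]] and eqs = eq[OF z]
        show "1/2 * g z + c * f (- z) = \<epsilon> * regsum s (\<lambda>z. 1/2 * g z + c * f (- z)) (2 + z) +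
            regsum s (\<lambda>z. 1/2 * g z + c * f (- z)) (3 - z)"
          using that
        proof (elim disjE conjE)
          assume e: "\<epsilon> = 1" "c = 1/2"
          show ?thesis unfolding e lins eqs by (simp add: algebra_simps)
        next
          assume e: "\<epsilon> = -1" "c = -1/2"
          show ?thesis unfolding e lins eqs by (simp add: algebra_simps)
        qed
      qed
      from this[of 1 "1/2"] this[of "-1" "-1/2"]
      show "parity (f, g) \<in> nearest_eig s 1 \<times> nearest_eig s (- 1)"
        unfolding parity_def by simp
    qed
    show "(\<lambda>(h, k). ((\<lambda>z. 1 * h (- z) + (- 1) * k (- z)), (\<lambda>z. 1 * h z + 1 * k z))) ` (nearest_eig s 1 \<times> nearest_eig s (- 1))
        \<subseteq> ker_on nearest_space (\<lambda>p. nearest_op s p - p)"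
    proof (rule image_subsetI, clarify)
      fix h k assume hk: "h \<in> nearest_eig s 1" "k \<in> nearest_eig s (- 1)"
      then have da: "h \<in> disk_algebra 0 1" "k \<in> disk_algebra 0 1" unfolding nearest_eig_def by auto
      show "((\<lambda>z. 1 * h (- z) + (- 1) * k (- z)), (\<lambda>z. 1 * h z + 1 * k z)) \<in> ker_on nearest_space (\<lambda>p. nearest_op s p - p)"
        unfolding ker
      proof (intro conjI ballI)
        show "(\<lambda>z. 1 * h (- z) + (- 1) * k (- z)) \<in> disk_algebra 0 1"
          by (intro disk_algebra_linear disk_algebra_uminus da)
        show "(\<lambda>z. 1 * h z + 1 * k z) \<in> disk_algebra 0 1"
          by (intro disk_algebra_linear da)
        fix z :: complex assume z: "z \<in> cball 0 1"
        have Re: "1 \<le> Re (2 + z)" "1 \<le> Re (3 - z)" using cball_Re_ge[OF z] cball_Re_le[OF z] by auto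
        note lin = Re[THEN regsum_linear_unit_disk[OF s(1) da]]
        have hz: "h z = regsum s h (2 + z) + regsum s h (3 - z)" "k z = - regsum s k (2 + z) + regsum s k (3 - z)"
          using hk z unfolding nearest_eig_def by auto
        show "1 * h (- (- z)) + (- 1) * k (- (- z)) = regsum s (\<lambda>u. 1 * h (- (- u)) + (- 1) * k (- (- u))) (3 - z) +
            regsum s (\<lambda>z. 1 * h z + 1 * k z) (2 + z)"
          unfolding minus_minus lin using hz by simp
        show "1 * h z + 1 * k z = regsum s (\<lambda>u. 1 * h (- (- u)) + (- 1) * k (- (- u))) (2 + z) +
            regsum s (\<lambda>z. 1 * h z + 1 * k z) (3 - z)"
          unfolding minus_minus lin using hz by simp
      qed
    qed
  qed (auto simp: parity_def fun_eq_iff prod_eq_iff add_divide_distrib diff_divide_distrib)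
qed

theorem theorem1p1:
  fixes s :: complex
  assumes "0 < Re s" and "Re s < 1" and "s \<noteq> 1/2"
  shows "\<exists>\<phi>. pair_linear_on
               (ker_on mayer_space (\<lambda>f. mayer_op s f - f) \<times> ker_on mayer_space (\<lambda>f. mayer_op s f + f)) \<phi> \<and>
             bij_betw \<phi>
               (ker_on mayer_space (\<lambda>f. mayer_op s f - f) \<times> ker_on mayer_space (\<lambda>f. mayer_op s f + f))
               (ker_on nearest_space (\<lambda>p. nearest_op s p - p))"
proof -
  note s = assms(1,3)
  define W where "W = ker_on nearest_space (\<lambda>p. nearest_op s p - p)"
  define V where "V = mayer_eig s 1 \<times> mayer_eig s (- 1)"
  define N where "N = nearest_eig s 1 \<times> nearest_eig s (- 1)"
  define \<psi> where "\<psi> = map_prod (to_mayer s 1) (to_mayer s (- 1))"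
  have par: "bij_betw parity W N"
    unfolding W_def N_def by (rule bij_betw_parity[OF s])
  have psi: "bij_betw \<psi> N V"
    unfolding \<psi>_def N_def V_def by (intro bij_betw_map_prod bij_betw_to_mayer s) simp_all
  \<comment> \<open>The maps constructed so far lead from the nearest integer side to Mayer's side,
    so the required one composes their inverses.\<close>
  define \<phi> where "\<phi> = (\<lambda>q. inv_into W parity (inv_into N \<psi> q))"
  \<comment> \<open>An explicit inverse of \<open>parity\<close>, from which linearity can be read
    off.\<close>
  define unparity where "unparity = (\<lambda>p :: (complex \<Rightarrow> complex) \<times> (complex \<Rightarrow> complex).
    ((\<lambda>z. fst p (- z) - snd p (- z)), (\<lambda>z. fst p z + snd p z)))"
  define comb where "comb c d p q = ((\<lambda>z. c * fst p z + d * fst q z), (\<lambda>z. c * snd p z + d * snd q z))"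
    for c d :: complex and p q :: "(complex \<Rightarrow> complex) \<times> (complex \<Rightarrow> complex)"
  have bij: "bij_betw \<phi> V W"
    using bij_betw_trans[OF bij_betw_inv_into[OF psi] bij_betw_inv_into[OF par]]
    unfolding \<phi>_def comp_def .
  have \<phi>_eq: "\<phi> (\<psi> p) = unparity p" if "p \<in> N" for p
  proof -
    have "inv_into N \<psi> (\<psi> p) = p" using bij_betw_inv_into_left[OF psi that] .
    then have "parity (\<phi> (\<psi> p)) = p"
      unfolding \<phi>_def using bij_betw_inv_into_right[OF par that] by simp
    moreover have "unparity (parity p) = p" for p
      by (auto simp: unparity_def parity_def fun_eq_iff prod_eq_iff)
    ultimately show ?thesis by metis
  qed
  have \<phi>_comb: "\<phi> (comb c d q r) = comb c d (\<phi> q) (\<phi> r)" if "q \<in> V" "r \<in> V" for c d q r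
  proof -
    have "q \<in> \<psi> ` N" "r \<in> \<psi> ` N"
      using that bij_betw_imp_surj_on[OF psi] by simp_all
    then obtain p p' where p: "p \<in> N" "q = \<psi> p" "p' \<in> N" "r = \<psi> p'"
      by (elim imageE)
    have "comb c d p p' \<in> N"
      using p nearest_eig_linear[OF s(1)] unfolding N_def comb_def by auto
    moreover have "comb c d q r = \<psi> (comb c d p p')"
      using p unfolding comb_def \<psi>_def N_def nearest_eig_def
      by (auto simp: to_mayer_linear[OF s(1)] map_prod_def)
    ultimately have "\<phi> (comb c d q r) = unparity (comb c d p p')"
      using \<phi>_eq by simp
    also have "\<dots> = comb c d (\<phi> q) (\<phi> r)"
      unfolding p \<phi>_eq[OF p(1)] \<phi>_eq[OF p(3)] by (simp add: unparity_def comb_def algebra_simps)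
    finally show ?thesis .
  qed
  \<comment> \<open>General linear combinations cover both clauses of linearity; scaling uses the
    coefficient 0 with a repeated argument.\<close>
  have "p + q = comb 1 1 p q" "pair_scale c p = comb c 0 p p" for c p q
    unfolding comb_def pair_scale_def by (auto simp: prod_eq_iff fun_eq_iff)
  then have "pair_linear_on V \<phi>"
    unfolding pair_linear_on_def using \<phi>_comb by simp
  then show ?thesis
    unfolding ker_mayer_op[OF s] using bij unfolding V_def W_def by blast
qed

end
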